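(* Let $G$ be a simple connected graph on $n\geq 5$ vertices with $G\neq K_n$, and let $s_3(G)$ be the third invariant factor of its Laplacian matrix $L(G)$. Then $s_3(G)\leq n$. Moreover, up to isomorphism: (i) $s_3(G)=n$ if and only if $G=K_n-e$, where $e$ is an edge of $K_n$; (ii) $s_3(G)=n-1$ if and only if $G=v\cdot K_{n-1}$; (iii) $s_3(G)=n-2$ if and only if $n=5$ and $G=K_5-2e$ or $G=K_5-C_4$; (iv) $s_3(G)=n-3$ if and only if $G$ is one of the following six graphs: $K_{2,3}$, $K_5-C_3$, $K_6-C_3$, $K_7-2C_3$, $K_{3,3}$, $K_7-K_{3,3}$.
   Context: For a simple graph $G$ with vertices $v_1,\dots,v_n$, the Laplacian matrix is $L(G)=D(G)-A(G)$, where $D(G)=\mathrm{diag}(d_1,\dots,d_n)$ is the diagonal matrix of vertex degrees and $A(G)$ is the $(0,1)$-adjacency matrix. Let $\Delta_i(G)$ be the greatest common divisor of all $i\times i$ minors of $L(G)$ (with $\Delta_0(G)=1$). The invariant factors are $s_{i+1}(G)=\Delta_{i+1}(G)/\Delta_i(G)$ for $0\leq i<n$ (the diagonal entries of the Smith normal form of $L(G)$ over the integers, taken nonnegative). Notation for graphs: $K_n$ is the complete graph, $K_{a,b}$ the complete bipartite graph. $K_n-e$ is $K_n$ with one edge deleted. $v\cdot K_{n-1}$ is the graph obtained from $K_{n-1}$ by adding a new vertex $v$ and one edge joining $v$ to a vertex of $K_{n-1}$. $K_5-2e$ is $K_5$ with two edges having no common vertex deleted. $K_5-C_4$ is $K_5$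 with the edges of a cycle of length 4 deleted. $K_m-C_3$ is $K_m$ with the three edges of a triangle deleted. $K_7-2C_3$ is $K_7$ with the six edges of two vertex-disjoint triangles deleted. $K_7-K_{3,3}$ is $K_7$ with the nine edges of a complete bipartite subgraph $K_{3,3}$ (on six of the seven vertices) deleted. *)

theory Defs
  imports
    "Graph_Theory.Graph_Theory"
    "Jordan_Normal_Form.Determinant"
    "Jordan_Normal_Form.DL_Submatrix"
begin

section \<open>Determinantal divisors and invariant factors of an integer matrix\<close>

definition minors :: "int mat \<Rightarrow> nat \<Rightarrow> int set" where
  "minors A i = {det (submatrix A I J) | I J.
     I \<subseteq> {..<dim_row A} \<and> J \<subseteq> {..<dim_col A} \<and> card I = i \<and> card J = i}"

definition det_divisor :: "int mat \<Rightarrow> nat \<Rightarrow> int" where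
  "det_divisor A i = Gcd (minors A i)"

text \<open>Indices start at 1. The divisions are exact, and by the convention \<open>x div 0 = 0\<close> the
  factors beyond the rank are 0, as in the Smith normal form.\<close>

definition invariant_factor :: "int mat \<Rightarrow> nat \<Rightarrow> int" where
  "invariant_factor A i = det_divisor A i div det_divisor A (i - 1)"


section \<open>Laplacian matrix\<close>

text \<open>A simple graph is a \<open>pair_graph\<close>: a finite vertex set with a symmetric irreflexive set of
  arcs, each edge being represented by its two arcs. Hence the degree of a vertex is its
  out-degree. The vertices are listed as \<open>v 0, \<dots>, v (n - 1)\<close>.\<close>

definition degree_mat :: "'a pair_pre_digraph \<Rightarrow> nat \<Rightarrow> (nat \<Rightarrow> 'a) \<Rightarrow> int mat" where
  "degree_mat G n v =
     mat n n (\<lambda>(i, j). if i = j then int (out_degree (with_proj G) (v i)) else 0)"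

definition adjacency_mat :: "'a pair_pre_digraph \<Rightarrow> nat \<Rightarrow> (nat \<Rightarrow> 'a) \<Rightarrow> int mat" where
  "adjacency_mat G n v = mat n n (\<lambda>(i, j). if (v i, v j) \<in> parcs G then 1 else 0)"

definition laplacian_mat :: "'a pair_pre_digraph \<Rightarrow> nat \<Rightarrow> (nat \<Rightarrow> 'a) \<Rightarrow> int mat" where
  "laplacian_mat G n v = degree_mat G n v - adjacency_mat G n v"


section \<open>Specific graphs\<close>

definition graph_iso :: "'a pair_pre_digraph \<Rightarrow> 'b pair_pre_digraph \<Rightarrow> bool"  (infix \<open>\<simeq>\<^sub>g\<close> 50) where
  "G \<simeq>\<^sub>g H \<longleftrightarrow> digraph_iso (with_proj G) (with_proj H)"

definition complete_graph :: "nat \<Rightarrow> nat pair_pre_digraph" where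
  "complete_graph n = \<lparr> pverts = {..<n}, parcs = {(x, y). x < n \<and> y < n \<and> x \<noteq> y} \<rparr>"

text \<open>An edge may be listed in \<open>F\<close> in either orientation.\<close>

definition complete_minus :: "nat \<Rightarrow> (nat \<times> nat) set \<Rightarrow> nat pair_pre_digraph" where
  "complete_minus n F = complete_graph n \<lparr> parcs := parcs (complete_graph n) - (F \<union> F\<inverse>) \<rparr>"

text \<open>The graph \<open>v \<cdot> K\<^bsub>n-1\<^esub>\<close>, for \<open>n \<ge> 2\<close>; the pendant vertex is \<open>n - 1\<close>, attached to \<open>0\<close>.\<close>

definition pendant_complete :: "nat \<Rightarrow> nat pair_pre_digraph" where
  "pendant_complete n = \<lparr> pverts = insert (n - 1) (pverts (complete_graph (n - 1))),
     parcs = parcs (complete_graph (n - 1)) \<union> {(n - 1, 0), (0, n - 1)} \<rparr>"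

definition K5_minus_2e :: "nat pair_pre_digraph" where
  "K5_minus_2e = complete_minus 5 {(0, 1), (2, 3)}"

definition K5_minus_C4 :: "nat pair_pre_digraph" where
  "K5_minus_C4 = complete_minus 5 {(0, 1), (1, 2), (2, 3), (3, 0)}"

definition K_minus_C3 :: "nat \<Rightarrow> nat pair_pre_digraph" where
  "K_minus_C3 m = complete_minus m {(0, 1), (1, 2), (2, 0)}"

definition K7_minus_2C3 :: "nat pair_pre_digraph" where
  "K7_minus_2C3 = complete_minus 7 {(0, 1), (1, 2), (2, 0), (3, 4), (4, 5), (5, 3)}"

definition K7_minus_K33 :: "nat pair_pre_digraph" where
  "K7_minus_K33 = complete_minus 7 ({0, 1, 2} \<times> {3, 4, 5})"

end

(* An induced path a - b - c gives a 2 x 2 block of the Laplacian L with determinant 1, so the second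
   determinantal divisor is 1 and s_3 is the gcd of the 3 x 3 minors. Moreover m divides s_3 iff the
   Schur complement of this block vanishes modulo m; then rows a, b and columns b, c determine L
   modulo m. For m >= n - 3 >= 2 this allows only five adjacency patterns to (a, b, c) for the
   remaining vertices (the classes P, Q, R, S, T), determines the adjacencies between the classes,
   and turns the degrees of a, b, c into congruences on the sizes of the classes. As these sizes add
   up to n - 3 <= m, only the listed graphs survive. Conversely, for each listed graph the Schur
   complement vanishes modulo the stated value and has a nonzero entry dividing it. *)

theory Submission
  imports Defs "HOL-Number_Theory.Cong"
begin

section \<open>Minors along arbitrary index tuples\<close>

text \<open>The block takes rows a, b and columns b, c because the entry (a, c) is 0: it is
  triangular with diagonal entries -1, so its determinant is 1 whatever the degree of b is. Schur
  entries in rows a, b or columns b, c vanish identically. At two distinct vertices outside the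
  path, an entry involves only adjacencies and the degree of b, so it decides whether the two are
  adjacent; the entries in column a and row c bring in the degrees of a and c. The bound n - 3
  counts the vertices off the path. Besides b, the vertices a and c have at most n - 3 neighbours,
  so their degrees are at most m + 1 < 2 * m; if m divides such a degree, the degree equals m. This
  is how congruences become equations between class sizes. The few remaining cases are closed by
  subtracting two divisibilities until m divides a number that is too small.\<close>

lemma det_permute_cols:
  fixes A :: "'a :: comm_ring_1 mat"
  assumes A: "A \<in> carrier_mat n n" and p: "p permutes {0..<n}"
  shows "det (mat n n (\<lambda>(i, j). A $$ (i, p j))) = signof p * det A"
proof -
  have p_lt: "p j < n" if "j < n" for j
    using permutes_in_image[OF p, of j] that by simp
  have "(mat n n (\<lambda>(i, j). A $$ (i, p j)))\<^sup>T = mat n n (\<lambda>(i, j). A\<^sup>T $$ (p i, j))"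
    using p_lt carrier_matD[OF A] by (intro eq_matI) auto
  then have "det (mat n n (\<lambda>(i, j). A $$ (i, p j))) = det (mat n n (\<lambda>(i, j). A\<^sup>T $$ (p i, j)))"
    using det_transpose[OF mat_carrier, of n "\<lambda>(i, j). A $$ (i, p j)"] by simp
  also have "\<dots> = signof p * det A"
    using A p by (subst det_permute_rows[of _ n]) (auto simp: det_transpose[OF A])
  finally show ?thesis .
qed

text \<open>\<open>pick\<close> enumerates a set increasingly, so the permutation sends i to the
  rank of \<open>r i\<close> in the image, that is, to the number of smaller elements there.\<close>

lemma ex_permutation_pick:
  assumes "inj_on r {0..<k}"
  obtains p where "p permutes {0..<k}" "\<And>i. i < k \<Longrightarrow> pick (r ` {0..<k}) (p i) = r i"
proof
  let ?I = "r ` {0..<k}"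
  let ?c = "\<lambda>i. card {a \<in> ?I. a < r i}"
  let ?p = "\<lambda>i. if i \<in> {0..<k} then ?c i else i"
  have pick: "pick ?I (?c i) = r i" if "i < k" for i
    using that by (intro pick_card_in_set) auto
  have "?c i < k" if "i < k" for i
  proof -
    have "r i \<in> ?I" using that by simp
    then have "{a \<in> ?I. a < r i} \<subset> ?I" by blast
    then have "?c i < card ?I" by (rule psubset_card_mono[rotated]) simp
    then show ?thesis using card_image[OF assms] by simp
  qed
  then have "?c ` {0..<k} \<subseteq> {0..<k}" by auto
  moreover have "inj_on ?c {0..<k}"
  proof (rule inj_onI)
    fix i j assume "i \<in> {0..<k}" "j \<in> {0..<k}" "?c i = ?c j"
    moreover from this have "r i = r j" using pick[of i] pick[of j] by (metis atLeastLessThan_iff)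
    ultimately show "i = j" using assms by (meson inj_onD)
  qed
  ultimately have "bij_betw ?c {0..<k} {0..<k}"
    using endo_inj_surj[of "{0..<k}" ?c] unfolding bij_betw_def by blast
  then have "bij_betw ?p {0..<k} {0..<k}"
    using bij_betw_cong[of "{0..<k}" ?p ?c "{0..<k}"] by simp
  then show "?p permutes {0..<k}"
    by (rule bij_imp_permutes) auto
  show "pick ?I (?p i) = r i" if "i < k" for i
    using pick[OF that] that by simp
qed

text \<open>Minors are indexed by sets, hence by increasing rows and columns, while the vertices of
  a path come in an arbitrary order and may coincide with the third index. A repetition makes the
  determinant 0; otherwise it is a minor up to the signs of two permutations.\<close>

lemma det_divisor_dvd_det:
  assumes A: "A \<in> carrier_mat n m"
    and r: "\<And>i. i < k \<Longrightarrow> r i < n" and c: "\<And>j. j < k \<Longrightarrow> c j < m"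
  shows "det_divisor A k dvd det (mat k k (\<lambda>(i, j). A $$ (r i, c j)))"
    (is "_ dvd det ?M")
proof -
  have M: "?M \<in> carrier_mat k k" by simp
  consider (rows) i j where "i < k" "j < k" "i \<noteq> j" "r i = r j"
    | (cols) i j where "i < k" "j < k" "i \<noteq> j" "c i = c j"
    | (inj) "inj_on r {0..<k}" "inj_on c {0..<k}"
    unfolding inj_on_def by fastforce
  then show ?thesis
  proof cases
    case rows
    then have "row ?M i = row ?M j" by (intro eq_vecI) auto
    then have "det ?M = 0" by (rule det_identical_rows[OF M rows(3,1,2)])
    then show ?thesis by simp
  next
    case cols
    then have "col ?M i = col ?M j" by (intro eq_vecI) auto
    then have "det ?M = 0" by (rule det_identical_columns[OF M cols(3,1,2)])
    then show ?thesis by simp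
  next
    case inj
    obtain p where p: "p permutes {0..<k}" "\<And>i. i < k \<Longrightarrow> pick (r ` {0..<k}) (p i) = r i"
      using ex_permutation_pick[OF inj(1)] by blast
    obtain q where q: "q permutes {0..<k}" "\<And>i. i < k \<Longrightarrow> pick (c ` {0..<k}) (q i) = c i"
      using ex_permutation_pick[OF inj(2)] by blast
    define S where "S = submatrix A (r ` {0..<k}) (c ` {0..<k})"
    have sub: "r ` {0..<k} \<subseteq> {..<n}" "c ` {0..<k} \<subseteq> {..<m}" using r c by auto
    then have "{i. i < n \<and> i \<in> r ` {0..<k}} = r ` {0..<k}" "{i. i < m \<and> i \<in> c ` {0..<k}} = c ` {0..<k}"
      by auto
    then have S_eq: "S = mat k k (\<lambda>(i, j). A $$ (pick (r ` {0..<k}) i, pick (c ` {0..<k}) j))"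
      unfolding S_def submatrix_def using A card_image[OF inj(1)] card_image[OF inj(2)] by simp
    have p_lt: "p i < k" if "i < k" for i using permutes_in_image[OF p(1), of i] that by simp
    have q_lt: "q i < k" if "i < k" for i using permutes_in_image[OF q(1), of i] that by simp
    have "?M = mat k k (\<lambda>(i, j). mat k k (\<lambda>(i, j). S $$ (p i, j)) $$ (i, q j))"
      using p p_lt q q_lt by (intro eq_matI) (auto simp: S_eq)
    then have "det ?M = signof q * (signof p * det S)"
      using p(1) q(1) by (subst det_permute_rows[of S k, symmetric], simp add: S_eq, simp)
        (subst det_permute_cols[of _ k, symmetric], auto)
    moreover have "det S \<in> minors A k"
      unfolding minors_def S_def using A sub card_image[OF inj(1)] card_image[OF inj(2)]
      by (intro CollectI exI[of _ "r ` {0..<k}"] exI[of _ "c ` {0..<k}"]) simp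
    then have "det_divisor A k dvd det S" unfolding det_divisor_def by (rule Gcd_dvd)
    ultimately show ?thesis by simp
  qed
qed

lemma dvd_det_divisorI:
  assumes A: "A \<in> carrier_mat n m"
    and dvd: "\<And>r c. (\<And>i. i < k \<Longrightarrow> r i < n) \<Longrightarrow> (\<And>j. j < k \<Longrightarrow> c j < m) \<Longrightarrow>
      d dvd det (mat k k (\<lambda>(i, j). A $$ (r i, c j)))"
  shows "d dvd det_divisor A k"
  unfolding det_divisor_def
proof (rule Gcd_greatest)
  fix x assume "x \<in> minors A k"
  then obtain I J where x: "x = det (submatrix A I J)"
    and IJ: "I \<subseteq> {..<n}" "J \<subseteq> {..<m}" "card I = k" "card J = k"
    using A unfolding minors_def by auto
  have eqs: "{i. i < n \<and> i \<in> I} = I" "{i. i < m \<and> i \<in> J} = J" using IJ by auto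
  have "x = det (mat k k (\<lambda>(i, j). A $$ (pick I i, pick J j)))"
    using A IJ eqs by (simp add: x submatrix_def)
  moreover have "pick I i < n" "pick J i < m" if "i < k" for i
    using pick_le[of i n I] pick_le[of i m J] that eqs IJ by auto
  ultimately show "d dvd x" using dvd by simp
qed

text \<open>Laplace expansion along row 0. The deleted column is absorbed into an index shift, so
  that the cofactors are again of the form \<open>mat k k\<close> and the expansion can be
  iterated.\<close>

lemma det_mat_Suc:
  fixes f :: "nat \<times> nat \<Rightarrow> 'a :: comm_ring_1"
  shows "det (mat (Suc k) (Suc k) f) =
    (\<Sum>j\<le>k. (- 1) ^ j * f (0, j) * det (mat k k (\<lambda>(i, l). f (Suc i, if l < j then l else Suc l))))"
proof -
  have "mat_delete (mat (Suc k) (Suc k) f) 0 j =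
      mat k k (\<lambda>(i, l). f (Suc i, if l < j then l else Suc l))" for j
    unfolding mat_delete_def by (intro eq_matI) auto
  then show ?thesis
    by (subst laplace_expansion_row[of _ "Suc k" 0])
      (auto simp: cofactor_def lessThan_Suc_atMost ac_simps intro!: sum.cong)
qed

lemma det_mat_2:
  fixes f :: "nat \<times> nat \<Rightarrow> 'a :: comm_ring_1"
  shows "det (mat 2 2 f) = f (0, 0) * f (1, 1) - f (0, 1) * f (1, 0)"
  by (simp only: numeral_2_eq_2 det_mat_Suc) simp

lemma det_mat_3:
  fixes f :: "nat \<times> nat \<Rightarrow> 'a :: comm_ring_1"
  shows "det (mat 3 3 f) =
      f (0, 0) * (f (1, 1) * f (2, 2) - f (1, 2) * f (2, 1))
    - f (0, 1) * (f (1, 0) * f (2, 2) - f (1, 2) * f (2, 0))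
    + f (0, 2) * (f (1, 0) * f (2, 1) - f (1, 1) * f (2, 0))"
  by (simp only: numeral_3_eq_3 det_mat_Suc) (simp add: numeral_2_eq_2)

text \<open>Modulo d the matrix is a sum of two rank-one matrices. The 3 x 3 determinant of such a
  sum is zero as a polynomial identity.\<close>

lemma dvd_det_divisor_3I:
  assumes A: "A \<in> carrier_mat n n"
    and rank2: "\<And>i j. i < n \<Longrightarrow> j < n \<Longrightarrow> [A $$ (i, j) = x i * u j + y i * w j] (mod d)"
  shows "d dvd det_divisor A 3"
proof (rule dvd_det_divisorI[OF A])
  fix r c :: "nat \<Rightarrow> nat"
  assume r: "\<And>i. i < 3 \<Longrightarrow> r i < n" and c: "\<And>j. j < 3 \<Longrightarrow> c j < n"
  define g where "g i j = x (r i) * u (c j) + y (r i) * w (c j)" for i j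
  have g: "[A $$ (r i, c j) = g i j] (mod d)" if "i < 3" "j < 3" for i j
    unfolding g_def using rank2 r c that by simp
  have "[det (mat 3 3 (\<lambda>(i, j). A $$ (r i, c j))) =
      g 0 0 * (g 1 1 * g 2 2 - g 1 2 * g 2 1)
    - g 0 1 * (g 1 0 * g 2 2 - g 1 2 * g 2 0)
    + g 0 2 * (g 1 0 * g 2 1 - g 1 1 * g 2 0)] (mod d)"
    unfolding det_mat_3 prod.case by (intro cong_add cong_diff cong_mult g) auto
  moreover have "g 0 0 * (g 1 1 * g 2 2 - g 1 2 * g 2 1)
    - g 0 1 * (g 1 0 * g 2 2 - g 1 2 * g 2 0)
    + g 0 2 * (g 1 0 * g 2 1 - g 1 1 * g 2 0) = 0"
    unfolding g_def by (simp add: algebra_simps)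
  ultimately show "d dvd det (mat 3 3 (\<lambda>(i, j). A $$ (r i, c j)))"
    by (simp add: cong_0_iff)
qed

section \<open>The third invariant factor and induced paths\<close>

text \<open>Indexing the Laplacian by vertices keeps the arguments about neighbourhoods free of the
  enumeration \<open>v\<close>.\<close>

definition lap :: "'a pair_pre_digraph \<Rightarrow> 'a \<Rightarrow> 'a \<Rightarrow> int" where
  "lap G x y = (if x = y then int (card {z. (x, z) \<in> parcs G})
     else if (x, y) \<in> parcs G then - 1 else 0)"

definition induced_path :: "'a pair_pre_digraph \<Rightarrow> 'a \<Rightarrow> 'a \<Rightarrow> 'a \<Rightarrow> bool" where
  "induced_path G a b c \<longleftrightarrow> (a, b) \<in> parcs G \<and> (b, c) \<in> parcs G \<and> a \<noteq> c \<and> (a, c) \<notin> parcs G"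

text \<open>The rows \<open>a, b\<close> and columns \<open>b, c\<close> of an induced path form a unimodular block; this is the
  entry \<open>(i, j)\<close> of its Schur complement, that is, the minor with rows \<open>a, b, i\<close> and columns
  \<open>b, c, j\<close>.\<close>

definition schur :: "'a pair_pre_digraph \<Rightarrow> 'a \<Rightarrow> 'a \<Rightarrow> 'a \<Rightarrow> 'a \<Rightarrow> 'a \<Rightarrow> int" where
  "schur G a b c i j =
     lap G i j + (lap G i b + lap G i c * lap G b b) * lap G a j + lap G i c * lap G b j"

lemma pair_graph_symD: "pair_graph G \<Longrightarrow> (x, y) \<in> parcs G \<Longrightarrow> (y, x) \<in> parcs G"
  using pair_sym_digraph.pair_sym_arcs[of G]
  by (auto simp: pair_graph_def pair_pseudo_graph_def symmetric_def dest: symD)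

lemma pair_graph_irrefl: "pair_graph G \<Longrightarrow> (x, x) \<notin> parcs G"
  using pair_loopfree_digraph.pair_no_loops[of G "(x, x)"]
  by (auto simp: pair_graph_def pair_digraph_def)

lemma pair_graph_vertsD:
  "pair_graph G \<Longrightarrow> (x, y) \<in> parcs G \<Longrightarrow> x \<in> pverts G \<and> y \<in> pverts G"
  by (auto simp: pair_graph_def pair_digraph_def pair_fin_digraph_def
      dest: pair_wf_digraph.in_arcsD1 pair_wf_digraph.in_arcsD2)

lemma pair_graph_wf: "pair_graph G \<Longrightarrow> pair_wf_digraph G"
  by (simp add: pair_graph_def pair_digraph_def pair_fin_digraph_def)

lemma pair_graph_finite: "pair_graph G \<Longrightarrow> finite (pverts G)"
  by (auto simp: pair_graph_def pair_digraph_def pair_fin_digraph_def pair_fin_digraph_axioms_def)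

lemma laplacian_mat_carrier: "laplacian_mat G n v \<in> carrier_mat n n"
  unfolding laplacian_mat_def adjacency_mat_def by (intro minus_carrier_mat mat_carrier)

lemma laplacian_mat_index:
  assumes "pair_graph G" "inj_on v {..<n}" "i < n" "j < n"
  shows "laplacian_mat G n v $$ (i, j) = lap G (v i) (v j)"
proof -
  have "out_arcs (with_proj G) x = Pair x ` {z. (x, z) \<in> parcs G}" for x
    by (auto simp: out_arcs_def)
  then have "out_degree (with_proj G) x = card {z. (x, z) \<in> parcs G}" for x
    by (simp add: out_degree_def card_image inj_on_def)
  moreover have "v i = v j \<longleftrightarrow> i = j" using assms by (auto dest: inj_onD)
  ultimately show ?thesis
    using assms(3,4) pair_graph_irrefl[OF assms(1), of "v j"]
    by (cases "i = j") (simp_all add: laplacian_mat_def degree_mat_def adjacency_mat_def lap_def)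
qed

locale enumerated_graph =
  fixes G :: "'a pair_pre_digraph" and n :: nat and v :: "nat \<Rightarrow> 'a"
  assumes graph: "pair_graph G" and enum: "bij_betw v {..<n} (pverts G)"
begin

abbreviation "s3 \<equiv> invariant_factor (laplacian_mat G n v) 3"

lemma laplacian_entry: "i < n \<Longrightarrow> j < n \<Longrightarrow> laplacian_mat G n v $$ (i, j) = lap G (v i) (v j)"
  using laplacian_mat_index[OF graph] enum by (auto simp: bij_betw_def)

lemma vertex_index: "x \<in> pverts G \<Longrightarrow> \<exists>i<n. v i = x"
  using bij_betw_imp_surj_on[OF enum] by (metis imageE lessThan_iff)

lemma induced_path_verts:
  "induced_path G a b c \<Longrightarrow> a \<in> pverts G \<and> b \<in> pverts G \<and> c \<in> pverts G"
  using pair_graph_vertsD[OF graph] by (auto simp: induced_path_def)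

lemma lap_induced_path:
  assumes "induced_path G a b c"
  shows "lap G a b = - 1" "lap G a c = 0" "lap G b c = - 1"
  using assms pair_graph_irrefl[OF graph] by (auto simp: induced_path_def lap_def)

lemma s3_eq_det_divisor:
  assumes "induced_path G a b c"
  shows "s3 = det_divisor (laplacian_mat G n v) 3"
proof -
  obtain ia ib ic where idx: "ia < n" "v ia = a" "ib < n" "v ib = b" "ic < n" "v ic = c"
    using induced_path_verts[OF assms] vertex_index by metis
  have "det_divisor (laplacian_mat G n v) 2 dvd
      det (mat 2 2 (\<lambda>(i, j). laplacian_mat G n v $$ (if i = 0 then ia else ib,
        if j = 0 then ib else ic)))"
    using idx by (intro det_divisor_dvd_det[OF laplacian_mat_carrier]) auto
  also have "\<dots> = 1"
    using idx lap_induced_path[OF assms] by (simp add: det_mat_2 laplacian_entry)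
  finally have "det_divisor (laplacian_mat G n v) 2 = 1"
    by (simp add: det_divisor_def)
  then show ?thesis by (simp add: invariant_factor_def)
qed

text \<open>The tuples a, b, x and b, c, y may contain repetitions, which
  \<open>det_divisor_dvd_det\<close> permits; hence x and y range over all vertices.\<close>

lemma s3_dvd_schur:
  assumes "induced_path G a b c" "x \<in> pverts G" "y \<in> pverts G"
  shows "s3 dvd schur G a b c x y"
proof -
  obtain ia ib ic ix iy where
    idx: "ia < n" "v ia = a" "ib < n" "v ib = b" "ic < n" "v ic = c" "ix < n" "v ix = x" "iy < n"
      "v iy = y"
    using induced_path_verts[OF assms(1)] vertex_index assms(2,3) by metis
  have "s3 dvd det (mat 3 3 (\<lambda>(i, j). laplacian_mat G n v $$
      (if i = 0 then ia else if i = 1 then ib else ix, if j = 0 then ib else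
        if j = 1 then ic else iy)))"
    unfolding s3_eq_det_divisor[OF assms(1)]
    using idx by (intro det_divisor_dvd_det[OF laplacian_mat_carrier]) auto
  also have "\<dots> = schur G a b c x y"
    using idx lap_induced_path[OF assms(1)]
    by (simp add: det_mat_3 laplacian_entry schur_def algebra_simps)
  finally show ?thesis .
qed

text \<open>Solving "Schur entry = 0" for the entry of L writes every row of L, modulo d, as a
  combination of rows a and b. So L has the two-term form that kills all 3 x 3 minors.\<close>

lemma dvd_s3I:
  assumes "induced_path G a b c"
    and dvd: "\<And>x y. x \<in> pverts G \<Longrightarrow> y \<in> pverts G \<Longrightarrow> d dvd schur G a b c x y"
  shows "d dvd s3"
  unfolding s3_eq_det_divisor[OF assms(1)]
proof (rule dvd_det_divisor_3I[OF laplacian_mat_carrier])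
  fix i j assume "i < n" "j < n"
  moreover from this have "v i \<in> pverts G" "v j \<in> pverts G" using enum by (auto simp: bij_betw_def)
  ultimately show "[laplacian_mat G n v $$ (i, j) =
      (- (lap G (v i) b + lap G (v i) c * lap G b b)) * lap G a (v j) + (- lap G (v i) c) * lap G b
        (v j)]
      (mod d)"
    using dvd[of "v i" "v j"] by (simp add: laplacian_entry cong_iff_dvd_diff schur_def algebra_simps)
qed

lemma s3_nonneg: "s3 \<ge> 0"
  by (simp add: invariant_factor_def det_divisor_def div_int_pos_iff)

lemma s3_eqI:
  assumes "induced_path G a b c" "d \<ge> 0"
    and "\<And>x y. x \<in> pverts G \<Longrightarrow> y \<in> pverts G \<Longrightarrow> d dvd schur G a b c x y"
    and "x0 \<in> pverts G" "y0 \<in> pverts G" "schur G a b c x0 y0 dvd d"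
  shows "s3 = d"
proof -
  have "s3 dvd d" using s3_dvd_schur[OF assms(1,4,5)] assms(6) by (rule dvd_trans)
  moreover have "d dvd s3" using dvd_s3I[OF assms(1,3)] .
  ultimately show ?thesis using zdvd_antisym_nonneg[of s3 d] s3_nonneg assms(2) by blast
qed

end

section \<open>Isomorphisms\<close>

text \<open>The map \<open>f\<close> goes from H to G because H will be a concrete graph on an
  initial segment of the naturals and \<open>f\<close> a listing of the vertices of G. As
  \<open>digraph_iso\<close> maps in the other direction, the isomorphism is built from the inverse
  of \<open>f\<close>.\<close>

lemma graph_isoI:
  assumes G: "pair_wf_digraph G" and H: "pair_wf_digraph H"
    and f: "bij_betw f (pverts H) (pverts G)"
    and arcs: "\<And>i j. i \<in> pverts H \<Longrightarrow> j \<in> pverts H \<Longrightarrow> (f i, f j) \<in> parcs G \<longleftrightarrow> (i, j) \<in> parcs H"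
  shows "G \<simeq>\<^sub>g H"
proof -
  interpret G: pair_wf_digraph G by fact
  interpret H: pair_wf_digraph H by fact
  define g where "g = inv_into (pverts H) f"
  have g: "bij_betw g (pverts G) (pverts H)"
    unfolding g_def by (rule bij_betw_inv_into[OF f])
  have fg: "f (g x) = x" if "x \<in> pverts G" for x
    unfolding g_def using that f by (simp add: bij_betw_inv_into_right)
  have gf: "g (f i) = i" if "i \<in> pverts H" for i
    unfolding g_def using that f by (simp add: bij_betw_inv_into_left)
  have g_in: "g x \<in> pverts H" if "x \<in> pverts G" for x
    using g that by (auto simp: bij_betw_def)
  have f_in: "f i \<in> pverts G" if "i \<in> pverts H" for i
    using f that by (auto simp: bij_betw_def)
  \<comment> \<open>Tail and head must be \<open>fst\<close> and \<open>snd\<close> for the image to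
    be literally \<open>with_proj H\<close>.\<close>
  let ?h = "\<lparr>iso_verts = g, iso_arcs = map_prod g g, iso_head = snd, iso_tail = fst\<rparr>"
  have "inj_on (map_prod g g) (parcs G)"
    by (rule inj_on_subset[OF map_prod_inj_on[of g "pverts G" g "pverts G"]])
      (use g G.in_arcsD1 G.in_arcsD2 in \<open>auto simp: bij_betw_def\<close>)
  then have "pre_digraph.digraph_isomorphism (with_proj G) ?h"
    using g G.wf_digraph
    by (simp add: pre_digraph.digraph_isomorphism_def bij_betw_def)
  moreover have "map_prod g g ` parcs G = parcs H"
  proof (intro equalityI subsetI)
    fix e assume "e \<in> map_prod g g ` parcs G"
    then obtain x y where "(x, y) \<in> parcs G" "e = (g x, g y)" by auto
    then show "e \<in> parcs H"
      using arcs[of "g x" "g y"] g_in fg G.in_arcsD1 G.in_arcsD2 by metis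
  next
    fix e assume "e \<in> parcs H"
    then obtain i j where e: "e = (i, j)" "(i, j) \<in> parcs H" by (cases e) auto
    then have "i \<in> pverts H" "j \<in> pverts H" using H.in_arcsD1 H.in_arcsD2 by blast+
    then show "e \<in> map_prod g g ` parcs G"
      using arcs[of i j] e gf by (intro image_eqI[of _ _ "(f i, f j)"]) auto
  qed
  then have "with_proj H = app_iso ?h (with_proj G)"
    using g by (simp add: app_iso_def with_proj_def bij_betw_def)
  ultimately show ?thesis unfolding graph_iso_def digraph_iso_def by blast
qed

text \<open>An abstract isomorphism has its own arc map. Since tail and head of the image graph are
  the projections, this map acts on arcs as the vertex map does on both ends, so the vertex map
  alone carries all the information.\<close>

lemma graph_isoE:
  assumes "G \<simeq>\<^sub>g H" and G: "pair_wf_digraph G"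
  obtains f where "bij_betw f (pverts H) (pverts G)"
    "\<And>i j. i \<in> pverts H \<Longrightarrow> j \<in> pverts H \<Longrightarrow> (f i, f j) \<in> parcs G \<longleftrightarrow> (i, j) \<in> parcs H"
proof -
  interpret G: pair_wf_digraph G by fact
  obtain h where iso: "G.digraph_isomorphism h" and H: "with_proj H = app_iso h (with_proj G)"
    using assms(1) unfolding graph_iso_def digraph_iso_def by blast
  define g where "g = iso_verts h"
  have inj: "inj_on g (pverts G)"
    using iso by (simp add: pre_digraph.digraph_isomorphism_def g_def)
  have verts: "pverts H = g ` pverts G"
    using arg_cong[OF H, of verts] by (simp add: g_def)
  have "iso_tail h = fst" "iso_head h = snd"
    using arg_cong[OF H, of tail] arg_cong[OF H, of head] by simp_all
  then have iso_arcs: "iso_arcs h (x, y) = (g x, g y)" if "(x, y) \<in> parcs G" for x y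
    using iso that by (intro prod_eqI) (force simp: pre_digraph.digraph_isomorphism_def g_def)+
  have parcs: "parcs H = iso_arcs h ` parcs G"
    using arg_cong[OF H, of arcs] by simp
  have arcs: "(g x, g y) \<in> parcs H \<longleftrightarrow> (x, y) \<in> parcs G" if xy: "x \<in> pverts G" "y \<in> pverts G" for x y
  proof
    assume "(g x, g y) \<in> parcs H"
    then obtain x' y' where "(x', y') \<in> parcs G" "(g x, g y) = (g x', g y')"
      unfolding parcs using iso_arcs by fastforce
    then show "(x, y) \<in> parcs G"
      using inj xy G.in_arcsD1 G.in_arcsD2 by (metis inj_onD prod.inject)
  next
    assume "(x, y) \<in> parcs G"
    then show "(g x, g y) \<in> parcs H" unfolding parcs using iso_arcs by (metis image_eqI)
  qed
  define f where "f = inv_into (pverts G) g"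
  have "bij_betw f (pverts H) (pverts G)"
    unfolding f_def using inj verts by (simp add: bij_betw_inv_into inj_on_imp_bij_betw)
  moreover have "(f i, f j) \<in> parcs G \<longleftrightarrow> (i, j) \<in> parcs H" if "i \<in> pverts H" "j \<in> pverts H" for i j
  proof -
    have "f i \<in> pverts G" "f j \<in> pverts G" "g (f i) = i" "g (f j) = j"
      using that verts unfolding f_def by (auto simp: inv_into_into f_inv_into_f)
    then show ?thesis using arcs by metis
  qed
  ultimately show ?thesis using that by blast
qed

lemma lap_iso:
  assumes G: "pair_wf_digraph G" and H: "pair_wf_digraph H"
    and f: "bij_betw f (pverts H) (pverts G)"
    and arcs: "\<And>i j. i \<in> pverts H \<Longrightarrow> j \<in> pverts H \<Longrightarrow> (f i, f j) \<in> parcs G \<longleftrightarrow> (i, j) \<in> parcs H"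
    and ij: "i \<in> pverts H" "j \<in> pverts H"
  shows "lap G (f i) (f j) = lap H i j"
proof -
  interpret G: pair_wf_digraph G by fact
  interpret H: pair_wf_digraph H by fact
  have "{z. (f i, z) \<in> parcs G} = f ` {z. (i, z) \<in> parcs H}"
  proof (intro equalityI subsetI)
    fix z assume "z \<in> {z. (f i, z) \<in> parcs G}"
    moreover from this obtain k where "k \<in> pverts H" "z = f k"
      using f G.in_arcsD2 by (fastforce simp: bij_betw_def)
    ultimately show "z \<in> f ` {z. (i, z) \<in> parcs H}" using arcs ij by auto
  qed (use arcs ij H.in_arcsD2 in auto)
  moreover have "inj_on f {z. (i, z) \<in> parcs H}"
    using f H.in_arcsD2 by (auto simp: bij_betw_def intro: inj_on_subset)
  ultimately have "card {z. (f i, z) \<in> parcs G} = card {z. (i, z) \<in> parcs H}"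
    by (simp add: card_image)
  moreover have "f i = f j \<longleftrightarrow> i = j" using f ij by (auto simp: bij_betw_def dest: inj_onD)
  ultimately show ?thesis
    using arcs[OF ij] by (cases "i = j") (simp_all add: lap_def)
qed

lemma (in enumerated_graph) s3_eqI_iso:
  assumes iso: "G \<simeq>\<^sub>g H" and H: "pair_wf_digraph H"
    and path: "induced_path H a b c" and d: "d \<ge> 0"
    and dvd: "\<And>x y. x \<in> pverts H \<Longrightarrow> y \<in> pverts H \<Longrightarrow> d dvd schur H a b c x y"
    and xy: "x0 \<in> pverts H" "y0 \<in> pverts H" "schur H a b c x0 y0 dvd d"
  shows "s3 = d"
proof -
  have G: "pair_wf_digraph G"
    using graph by (rule pair_graph_wf)
  obtain f where f: "bij_betw f (pverts H) (pverts G)"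
    and arcs: "\<And>i j. i \<in> pverts H \<Longrightarrow> j \<in> pverts H \<Longrightarrow> (f i, f j) \<in> parcs G \<longleftrightarrow> (i, j) \<in> parcs H"
    using graph_isoE[OF iso G] by blast
  have abc: "a \<in> pverts H" "b \<in> pverts H" "c \<in> pverts H"
    using path H pair_wf_digraph.in_arcsD1 pair_wf_digraph.in_arcsD2
    unfolding induced_path_def by metis+
  have schur: "schur G (f a) (f b) (f c) (f x) (f y) = schur H a b c x y"
    if "x \<in> pverts H" "y \<in> pverts H" for x y
    using that abc lap_iso[OF G H f arcs] by (simp add: schur_def)
  have surj: "\<exists>x'\<in>pverts H. x = f x'" if "x \<in> pverts G" for x
    using f that by (auto simp: bij_betw_def)
  show ?thesis
  proof (rule s3_eqI[of "f a" "f b" "f c" d "f x0" "f y0"])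
    have "f a \<noteq> f c" using path abc f by (auto simp: induced_path_def bij_betw_def dest: inj_onD)
    then show "induced_path G (f a) (f b) (f c)"
      using path arcs abc by (simp add: induced_path_def)
    show "d dvd schur G (f a) (f b) (f c) x y" if xy: "x \<in> pverts G" "y \<in> pverts G" for x y
      using surj[OF xy(1)] surj[OF xy(2)] dvd schur by auto
    show "f x0 \<in> pverts G" "f y0 \<in> pverts G" using f xy by (auto simp: bij_betw_def)
  qed (use d xy schur in auto)
qed

section \<open>The third invariant factor of the extremal graphs\<close>

lemma pverts_complete_minus [simp]: "pverts (complete_minus n F) = {..<n}"
  by (simp add: complete_minus_def complete_graph_def)

lemma parcs_complete_minus:
  "(i, j) \<in> parcs (complete_minus n F) \<longleftrightarrow> i < n \<and> j < n \<and> i \<noteq> j \<and> (i, j) \<notin> F \<and> (j, i) \<notin> F"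
  by (auto simp: complete_minus_def complete_graph_def)

lemma complete_minus_wf: "pair_wf_digraph (complete_minus n F)"
  by unfold_locales (auto simp: complete_minus_def complete_graph_def)

text \<open>The degree is written as a sum over a list, the form in which it can be evaluated for a
  concrete graph.\<close>

lemma lap_complete_minus:
  assumes "i < n"
  shows "lap (complete_minus n F) i j =
    (if i = j then (\<Sum>z\<leftarrow>[0..<n]. if i \<noteq> z \<and> (i, z) \<notin> F \<and> (z, i) \<notin> F then 1 else 0)
     else if j < n \<and> (i, j) \<notin> F \<and> (j, i) \<notin> F then - 1 else 0)"
proof -
  have "{z. (i, z) \<in> parcs (complete_minus n F)} = {z \<in> {..<n}. i \<noteq> z \<and> (i, z) \<notin> F \<and> (z, i) \<notin> F}"
    using assms by (auto simp: parcs_complete_minus)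
  then have "int (card {z. (i, z) \<in> parcs (complete_minus n F)}) =
      (\<Sum>z<n. if i \<noteq> z \<and> (i, z) \<notin> F \<and> (z, i) \<notin> F then 1 else 0)"
    by (simp add: sum.If_cases Int_def)
  then show ?thesis
    using assms by (auto simp: lap_def parcs_complete_minus interv_sum_list_conv_sum_set_nat
      atLeast0LessThan)
qed

lemma pverts_pendant_complete: "n \<ge> 2 \<Longrightarrow> pverts (pendant_complete n) = {..<n}"
  by (auto simp: pendant_complete_def complete_graph_def)

lemma parcs_pendant_complete:
  "(i, j) \<in> parcs (pendant_complete n) \<longleftrightarrow>
     i < n - 1 \<and> j < n - 1 \<and> i \<noteq> j \<or> i = n - 1 \<and> j = 0 \<or> i = 0 \<and> j = n - 1"
  by (auto simp: pendant_complete_def complete_graph_def)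

lemma pendant_complete_wf: "n \<ge> 2 \<Longrightarrow> pair_wf_digraph (pendant_complete n)"
  by unfold_locales (auto simp: pendant_complete_def complete_graph_def)

lemma lap_pendant_complete:
  assumes "n \<ge> 3" "i < n"
  shows "lap (pendant_complete n) i j =
    (if i = j then (if i = n - 1 then 1 else if i = 0 then int n - 1 else int n - 2)
     else if j < n \<and> (i < n - 1 \<and> j < n - 1 \<or> i = n - 1 \<and> j = 0 \<or> i = 0 \<and> j = n - 1) then - 1 else 0)"
proof -
  have "{z. (i, z) \<in> parcs (pendant_complete n)} =
      (if i = n - 1 then {0} else if i = 0 then {..<n} - {0} else {..<n - 1} - {i})"
    using assms by (auto simp: parcs_pendant_complete)
  then have "int (card {z. (i, z) \<in> parcs (pendant_complete n)}) =
      (if i = n - 1 then 1 else if i = 0 then int n - 1 else int n - 2)"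
    using assms by (auto simp: card_Diff_singleton_if of_nat_diff)
  then show ?thesis using assms by (auto simp: lap_def parcs_pendant_complete)
qed

text \<open>The expression expanded in the proof is the minor with rows a, b, x and columns b, c, y.
  It vanishes for a sum of two rank-one matrices and reduces to \<open>schur\<close> once the path
  entries -1, 0, -1 are inserted.\<close>

lemma dvd_schurI:
  assumes path: "induced_path G a b c" and irrefl: "(b, b) \<notin> parcs G" "(a, a) \<notin> parcs G"
    "(c, c) \<notin> parcs G"
    and lap: "\<And>i j. i \<in> V \<Longrightarrow> j \<in> V \<Longrightarrow> [lap G i j = f i * g j + h i * k j] (mod d)"
    and V: "a \<in> V" "b \<in> V" "c \<in> V" "x \<in> V" "y \<in> V"
  shows "d dvd schur G a b c x y"
proof -
  have L: "lap G a b = - 1" "lap G a c = 0" "lap G b c = - 1"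
    using path irrefl by (auto simp: induced_path_def lap_def)
  define F where "F i j = f i * g j + h i * k j" for i j
  have "[lap G a b * (lap G b c * lap G x y - lap G b y * lap G x c)
    - lap G a c * (lap G b b * lap G x y - lap G b y * lap G x b)
    + lap G a y * (lap G b b * lap G x c - lap G b c * lap G x b)
    = F a b * (F b c * F x y - F b y * F x c)
    - F a c * (F b b * F x y - F b y * F x b)
    + F a y * (F b b * F x c - F b c * F x b)] (mod d)"
    unfolding F_def using V by (intro cong_add cong_diff cong_mult lap)
  moreover have "F a b * (F b c * F x y - F b y * F x c)
    - F a c * (F b b * F x y - F b y * F x b)
    + F a y * (F b b * F x c - F b c * F x b) = 0"
    unfolding F_def by (simp add: algebra_simps)
  ultimately show ?thesis
    by (simp add: L schur_def cong_0_iff algebra_simps)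
qed

context enumerated_graph
begin

lemma s3_complete_minus_edge:
  assumes "n \<ge> 5" "p < n" "q < n" "p \<noteq> q" "G \<simeq>\<^sub>g complete_minus n {(p, q)}"
  shows "s3 = int n"
proof -
  let ?H = "complete_minus n {(p, q)}"
  \<comment> \<open>Three vertices off the missing edge are needed: r is the middle of the induced
    path p - r - q, and (s, t) is the position of a Schur entry equal to -1 + (-1 - (n - 1)) * (-1)
    + 1 = n.\<close>
  have "card ({..<n} - {p, q}) = n - 2" using assms by (simp add: card_Diff_subset)
  then have "3 \<le> card ({..<n} - {p, q})" using assms by simp
  then obtain T where "T \<subseteq> {..<n} - {p, q}" "card T = 3" by (meson obtain_subset_with_card_n)
  then obtain r s t where rst: "r < n" "s < n" "t < n" "r \<notin> {p, q}" "s \<notin> {p, q}" "t \<notin> {p, q}"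
    and ne: "r \<noteq> s" "r \<noteq> t" "s \<noteq> t"
    by (auto simp: card_3_iff)
  define e where "e i = (if i = p then 1 else if i = q then - 1 else 0 :: int)" for i
  have deg: "(\<Sum>z<n. if i \<noteq> z \<and> (i, z) \<notin> {(p, q)} \<and> (z, i) \<notin> {(p, q)} then 1 else 0) =
    int n - 1 - e i * e i" if "i < n" for i
  proof -
    have "{z \<in> {..<n}. i \<noteq> z \<and> (i, z) \<notin> {(p, q)} \<and> (z, i) \<notin> {(p, q)}} =
      {..<n} - (if i \<in> {p, q} then {p, q} else {i})" using assms(4) by auto
    moreover have "int (card \<dots>) = int n - 1 - e i * e i"
      using that assms(1-4) by (simp add: card_Diff_subset of_nat_diff e_def)
    ultimately show ?thesis by (simp add: sum.If_cases Int_def)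
  qed
  \<comment> \<open>With the signed indicator \<open>e\<close> of the missing edge and the all-ones matrix \<open>J\<close>, this is
    \<open>L = n I - J - e e\<^sup>T\<close>, which has rank 2 modulo \<open>n\<close>.\<close>
  have lap: "lap ?H i j = - 1 * 1 + (- e i) * e j + int n * (if i = j then 1 else 0)"
    if "i < n" "j < n" for i j
    using assms(4) that deg[of i] by (cases "i = j") (auto simp: lap_complete_minus
      interv_sum_list_conv_sum_set_nat atLeast0LessThan e_def)
  have path: "induced_path ?H p r q"
    using rst assms(2-4) by (simp add: induced_path_def parcs_complete_minus)
  show ?thesis
  proof (rule s3_eqI_iso[OF assms(5) complete_minus_wf path, of "int n" s t])
    show "int n dvd schur ?H p r q x y" if "x \<in> pverts ?H" "y \<in> pverts ?H" for x y
    proof (rule dvd_schurI[OF path, where V = "{..<n}"])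
      show "[lap ?H i j = - 1 * 1 + (- e i) * e j] (mod int n)" if "i \<in> {..<n}" "j \<in> {..<n}" for i j
        using that by (simp add: lap cong_iff_dvd_diff)
    qed (use that rst assms(2,3) in \<open>auto simp: parcs_complete_minus\<close>)
    show "schur ?H p r q s t dvd int n"
      using rst ne assms(2,3,4) by (simp add: schur_def lap) (auto simp: e_def)
  qed (use rst in auto)
qed

lemma s3_pendant_complete:
  assumes "n \<ge> 5" "G \<simeq>\<^sub>g pendant_complete n"
  shows "s3 = int n - 1"
proof -
  let ?H = "pendant_complete n"
  \<comment> \<open>Modulo n - 1, \<open>g\<close> is the row of every clique vertex other than 0
    and \<open>h\<close> is the row of 0; the row of the pendant vertex n - 1 is \<open>g\<close>
    minus \<open>h\<close>.\<close>
  define g where "g i = (if i = n - 1 then 0 else - 1 :: int)" for i :: nat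
  define h where "h i = (if i = 0 then 0 else - 1 :: int)" for i :: nat
  have lap:
    "lap ?H i j = (if i = 0 then 0 else 1) * g j + (if i = 0 then 1 else if i = n - 1 then - 1 else 0) * h j
      + (int n - 1) * (if i = j \<and> i \<noteq> n - 1 then 1 else 0)"
    if "i < n" "j < n" for i j
    using assms(1) that by (auto simp: lap_pendant_complete g_def h_def)
  have path: "induced_path ?H 1 0 (n - 1)"
    using assms(1) by (auto simp: induced_path_def parcs_pendant_complete)
  show ?thesis
  proof (rule s3_eqI_iso[OF assms(2) pendant_complete_wf path, of "int n - 1" 2 1])
    show "int n - 1 dvd schur ?H 1 0 (n - 1) x y" if "x \<in> pverts ?H" "y \<in> pverts ?H" for x y
    proof (rule dvd_schurI[OF path, where V = "{..<n}"])
      show "[lap ?H i j = (if i = 0 then 0 else 1) * g j + (if i = 0 then 1 else if i = n - 1 then - 1 else 0) * h j]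
        (mod int n - 1)" if "i \<in> {..<n}" "j \<in> {..<n}" for i j
        unfolding cong_iff_dvd_diff using that by (subst lap) auto
    qed (use that assms(1) in \<open>auto simp: parcs_pendant_complete pverts_pendant_complete\<close>)
    \<comment> \<open>Vertex 2 is not adjacent to the pendant vertex, so this entry is -1 - (n - 2)
      = -(n - 1).\<close>
    show "schur ?H 1 0 (n - 1) 2 1 dvd int n - 1"
      using assms(1) minus_dvd_iff[of "int n - 1" "int n - 1"]
      by (auto simp: schur_def lap_pendant_complete)
  qed (use assms in \<open>auto simp: pverts_pendant_complete\<close>)
qed

end

text \<open>Unlike \<open>lap\<close> and \<open>schur\<close>, the following two functions are executable, so that the finitely many
  divisibilities for a concrete graph can be settled by \<open>code_simp\<close>.\<close>

definition lap_fun :: "nat \<Rightarrow> (nat \<times> nat) set \<Rightarrow> nat \<Rightarrow> nat \<Rightarrow> int" where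
  "lap_fun m F i j =
    (if i = j then (\<Sum>z\<leftarrow>[0..<m]. if i \<noteq> z \<and> (i, z) \<notin> F \<and> (z, i) \<notin> F then 1 else 0)
     else if (i, j) \<notin> F \<and> (j, i) \<notin> F then - 1 else 0)"

definition schur_fun :: "nat \<Rightarrow> (nat \<times> nat) set \<Rightarrow> nat \<Rightarrow> nat \<Rightarrow> nat \<Rightarrow> nat \<Rightarrow> nat \<Rightarrow> int" where
  "schur_fun m F a b c x y = lap_fun m F x y +
     (lap_fun m F x b + lap_fun m F x c * lap_fun m F b b) * lap_fun m F a y + lap_fun m F x c *
       lap_fun m F b y"

text \<open>As the complement of two disjoint cliques, the graph falls under the same evaluation and
  recognition lemmas as the other concrete graphs.\<close>

definition complete_bipartite_graph :: "nat \<Rightarrow> nat \<Rightarrow> nat pair_pre_digraph" where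
  "complete_bipartite_graph k l =
     complete_minus (k + l) ({0..<k} \<times> {0..<k} \<union> {k..<k + l} \<times> {k..<k + l})"

text \<open>Listing one side before the other gives the isomorphism. Conversely, adjacency in the
  model means that exactly one index is below k, so the images of the two index blocks are the
  sides.\<close>

lemma complete_bipartite_digraph_iff:
  assumes "pair_graph G"
  shows "complete_bipartite_digraph k l (with_proj G) \<longleftrightarrow> G \<simeq>\<^sub>g complete_bipartite_graph k l"
    (is "?L \<longleftrightarrow> ?R")
proof
  assume ?L
  then obtain U V where UV: "pverts G = U \<union> V" "U \<inter> V = {}" "card U = k" "card V = l"
    "parcs G = U \<times> V \<union> V \<times> U"
    unfolding complete_bipartite_digraph_pair_def by blast
  have fin: "finite U" "finite V" using pair_graph_finite[OF assms] UV(1) by auto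
  obtain g where g: "bij_betw g {0..<k} U" using ex_bij_betw_nat_finite[OF fin(1)] UV(3) by blast
  obtain h where "bij_betw h {0..<l} V" using ex_bij_betw_nat_finite[OF fin(2)] UV(4) by blast
  moreover have "bij_betw (\<lambda>i. i - k) {k..<k + l} {0..<l}"
    by (rule bij_betwI[of _ _ _ "\<lambda>i. i + k"]) auto
  ultimately obtain h' where h: "bij_betw h' {k..<k + l} V" using bij_betw_trans by blast
  define f where "f i = (if i \<in> {0..<k} then g i else h' i)" for i
  have "bij_betw f ({0..<k} \<union> {k..<k + l}) (U \<union> V)"
    unfolding f_def using g h UV(2) by (intro bij_betw_disjoint_Un) auto
  moreover have "{0..<k} \<union> {k..<k + l} = {..<k + l}" by auto
  ultimately have f: "bij_betw f {..<k + l} (pverts G)" using UV(1) by simp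
  have fU: "f i \<in> U \<and> f i \<notin> V" if "i < k" for i
    using that bij_betwE[OF g] UV(2) by (auto simp: f_def)
  have fV: "f i \<in> V \<and> f i \<notin> U" if "i < k + l" "\<not> i < k" for i
    using that bij_betwE[OF h] UV(2) by (auto simp: f_def)
  show ?R
    unfolding complete_bipartite_graph_def
  proof (rule graph_isoI[of _ _ f])
    show "pair_wf_digraph G"
      using assms by (rule pair_graph_wf)
    show "(f i, f j) \<in> parcs G \<longleftrightarrow>
        (i, j) \<in> parcs (complete_minus (k + l) ({0..<k} \<times> {0..<k} \<union> {k..<k + l} \<times> {k..<k + l}))"
      if "i \<in> pverts (complete_minus (k + l) ({0..<k} \<times> {0..<k} \<union> {k..<k + l} \<times> {k..<k + l}))"
        "j \<in> pverts (complete_minus (k + l) ({0..<k} \<times> {0..<k} \<union> {k..<k + l} \<times> {k..<k + l}))" for i j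
      using that fU[of i] fU[of j] fV[of i] fV[of j]
      by (cases "i < k"; cases "j < k") (auto simp: UV(5) parcs_complete_minus)
  qed (use f in \<open>simp_all add: complete_minus_wf\<close>)
next
  let ?F = "{0..<k} \<times> {0..<k} \<union> {k..<k + l} \<times> {k..<k + l}"
  assume ?R
  then have iso: "G \<simeq>\<^sub>g complete_minus (k + l) ?F" by (simp add: complete_bipartite_graph_def)
  have G: "pair_wf_digraph G"
    using assms by (rule pair_graph_wf)
  interpret G: pair_wf_digraph G by fact
  obtain f where "bij_betw f (pverts (complete_minus (k + l) ?F)) (pverts G)"
    and "\<And>i j. i \<in> pverts (complete_minus (k + l) ?F) \<Longrightarrow> j \<in> pverts (complete_minus (k + l) ?F) \<Longrightarrow>
      (f i, f j) \<in> parcs G \<longleftrightarrow> (i, j) \<in> parcs (complete_minus (k + l) ?F)"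
    using graph_isoE[OF iso G] by blast
  then have f: "bij_betw f {..<k + l} (pverts G)"
    and arcs: "\<And>i j. i < k + l \<Longrightarrow> j < k + l \<Longrightarrow> (f i, f j) \<in> parcs G \<longleftrightarrow> (i < k) \<noteq> (j < k)"
    by (auto simp: parcs_complete_minus)
  have split: "{..<k + l} = {0..<k} \<union> {k..<k + l}" by auto
  have inj: "inj_on f ({0..<k} \<union> {k..<k + l})" using f by (simp add: bij_betw_def split)
  have verts: "pverts G = f ` {0..<k} \<union> f ` {k..<k + l}"
    using f by (simp add: bij_betw_def split image_Un)
  have "parcs G = f ` {0..<k} \<times> f ` {k..<k + l} \<union> f ` {k..<k + l} \<times> f ` {0..<k}"
  proof (intro equalityI subsetI)
    fix e assume e: "e \<in> parcs G"
    then obtain x y where xy: "e = (x, y)" "x \<in> pverts G" "y \<in> pverts G"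
      using G.in_arcsD1 G.in_arcsD2 by (cases e) blast
    then obtain i j where ij: "i < k + l" "j < k + l" "x = f i" "y = f j"
      using bij_betw_imp_surj_on[OF f] by (metis imageE lessThan_iff)
    then have "(i < k) \<noteq> (j < k)" using e xy arcs by simp
    then show "e \<in> f ` {0..<k} \<times> f ` {k..<k + l} \<union> f ` {k..<k + l} \<times> f ` {0..<k}"
      using ij xy by (cases "i < k") auto
  qed (auto simp: arcs)
  moreover have "f ` {0..<k} \<inter> f ` {k..<k + l} = {}"
    using inj_on_image_Int[OF inj, of "{0..<k}" "{k..<k + l}"] by simp
  moreover have "card (f ` {0..<k}) = k" "card (f ` {k..<k + l}) = l"
    using inj by (simp_all add: card_image inj_on_Un)
  ultimately show ?L
    unfolding complete_bipartite_digraph_pair_def using verts pair_graph_finite[OF assms] by blast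
qed

lemma schur_complete_minus:
  assumes "a < m" "b < m" "c < m" "x < m" "y < m"
  shows "schur (complete_minus m F) a b c x y = schur_fun m F a b c x y"
  using assms by (simp add: schur_def schur_fun_def lap_complete_minus lap_fun_def)

text \<open>All conditions on the concrete graph form one closed statement with list quantifiers and
  remainders, so a single evaluation decides it. The path is a - b - c, and (r, s) is the position
  of a Schur entry dividing d.\<close>

lemma (in enumerated_graph) s3_complete_minus:
  assumes "G \<simeq>\<^sub>g complete_minus m F" "int d = D" 
    and "list_all (\<lambda>x. x < m) [a, b, c, r, s] \<and> (a, b) \<notin> F \<and> (b, a) \<notin> F \<and> (b, c) \<notin> F \<and> (c, b) \<notin> F \<and> 
      a \<noteq> b \<and> b \<noteq> c \<and> a \<noteq> c \<and> ((a, c) \<in> F \<or> (c, a) \<in> F) \<and>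
      list_all (\<lambda>x. list_all (\<lambda>y. schur_fun m F a b c x y mod int d = 0) [0..<m]) [0..<m] \<and>
      int d mod schur_fun m F a b c r s = 0"
  shows "s3 = D"
  using assms(2,3) 
  by (intro s3_eqI_iso[OF assms(1) complete_minus_wf, of a b c _ r s])
    (auto simp: induced_path_def parcs_complete_minus schur_complete_minus list_all_iff
      mod_eq_0_iff_dvd)

section \<open>Values for the eight sporadic graphs\<close>

context enumerated_graph
begin

lemma s3_K5_minus_2e: "G \<simeq>\<^sub>g K5_minus_2e \<Longrightarrow> s3 = 3"
  unfolding K5_minus_2e_def
  by (erule s3_complete_minus[where d = 3 and a = 0 and b = 2 and c = 1 and r = 3 and s = 4], simp,
    code_simp)

lemma s3_K5_minus_C4: "G \<simeq>\<^sub>g K5_minus_C4 \<Longrightarrow> s3 = 3"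
  unfolding K5_minus_C4_def
  by (erule s3_complete_minus[where d = 3 and a = 0 and b = 4 and c = 1 and r = 1 and s = 3], simp,
    code_simp)

lemma s3_K5_minus_C3: "G \<simeq>\<^sub>g K_minus_C3 5 \<Longrightarrow> s3 = 2"
  unfolding K_minus_C3_def
  by (erule s3_complete_minus[where d = 2 and a = 0 and b = 3 and c = 1 and r = 1 and s = 2], simp,
    code_simp)

lemma s3_K6_minus_C3: "G \<simeq>\<^sub>g K_minus_C3 6 \<Longrightarrow> s3 = 3"
  unfolding K_minus_C3_def
  by (erule s3_complete_minus[where d = 3 and a = 0 and b = 3 and c = 1 and r = 1 and s = 2], simp,
    code_simp)

lemma s3_K7_minus_2C3: "G \<simeq>\<^sub>g K7_minus_2C3 \<Longrightarrow> s3 = 4"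
  unfolding K7_minus_2C3_def
  by (erule s3_complete_minus[where d = 4 and a = 0 and b = 3 and c = 1 and r = 1 and s = 2], simp,
    code_simp)

lemma s3_K7_minus_K33: "G \<simeq>\<^sub>g K7_minus_K33 \<Longrightarrow> s3 = 4"
  unfolding K7_minus_K33_def
  by (erule s3_complete_minus[where d = 4 and a = 0 and b = 6 and c = 3 and r = 1 and s = 0], simp,
    code_simp)

lemma s3_K23: "G \<simeq>\<^sub>g complete_bipartite_graph 2 3 \<Longrightarrow> s3 = 2"
  unfolding complete_bipartite_graph_def
  by (erule s3_complete_minus[where d = 2 and a = 0 and b = 2 and c = 1 and r = 3 and s = 4], simp,
    code_simp)

lemma s3_K33: "G \<simeq>\<^sub>g complete_bipartite_graph 3 3 \<Longrightarrow> s3 = 3"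
  unfolding complete_bipartite_graph_def
  by (erule s3_complete_minus[where d = 3 and a = 0 and b = 3 and c = 1 and r = 1 and s = 2], simp,
    code_simp)

end

section \<open>Existence of induced paths\<close>

lemma connected_rtrancl:
  assumes "pair_graph G" "Digraph_Component.connected (with_proj G)" "x \<in> pverts G" "y \<in> pverts G"
  shows "(x, y) \<in> (parcs G)\<^sup>*"
proof -
  interpret pair_graph G by fact
  have "strongly_connected (with_proj G)"
    using symmetric_connected_imp_strongly_connected[OF pair_sym_arcs assms(2)] .
  then have "x \<rightarrow>\<^sup>*\<^bsub>with_proj G\<^esub> y" using assms(3,4) by (simp add: strongly_connected_def)
  then have "(x, y) \<in> rtrancl_on (pverts G) (parcs G)" by (simp add: reachable_def)
  then show ?thesis by (rule rtrancl_on_rtranclI)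
qed

lemma ex_neighbour:
  assumes "pair_graph G" "Digraph_Component.connected (with_proj G)" "x \<in> pverts G" "y \<in> pverts G"
    "x \<noteq> y"
  shows "\<exists>z. (x, z) \<in> parcs G"
  using connected_rtrancl[OF assms(1-4)] assms(5) by (auto elim: converse_rtranclE)

text \<open>Without an induced path, x together with its neighbours is closed under adjacency, so by
  connectedness it would contain y.\<close>

lemma ex_induced_path:
  assumes "pair_graph G" "Digraph_Component.connected (with_proj G)"
    and "x \<in> pverts G" "y \<in> pverts G" "x \<noteq> y" "(x, y) \<notin> parcs G"
  shows "\<exists>a b c. induced_path G a b c"
proof (rule ccontr)
  assume no_path: "\<nexists>a b c. induced_path G a b c"
  have "x = z \<or> (x, z) \<in> parcs G" if "(x, z) \<in> (parcs G)\<^sup>*" for z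
    using that
  proof induction
    case (step z w)
    then show ?case using no_path unfolding induced_path_def by blast
  qed simp
  then show False using connected_rtrancl[OF assms(1-4)] assms(5,6) by blast
qed

section \<open>Recognising the extremal graphs\<close>

lemma graph_iso_nthI:
  assumes G: "pair_graph G" and H: "pair_wf_digraph H" "pverts H = {..<m}"
    and xs: "distinct xs" "length xs = m" "set xs = pverts G"
    and arcs: "\<And>i j. i < m \<Longrightarrow> j < m \<Longrightarrow> (xs ! i, xs ! j) \<in> parcs G \<longleftrightarrow> (i, j) \<in> parcs H"
  shows "G \<simeq>\<^sub>g H"
proof (rule graph_isoI)
  show "pair_wf_digraph G"
    using G by (rule pair_graph_wf)
  show "bij_betw ((!) xs) (pverts H) (pverts G)"
    using bij_betw_nth[OF xs(1), of "{..<m}" "pverts G"] xs H by simp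
qed (use arcs H in simp_all)

text \<open>By symmetry and irreflexivity only the pairs i < j need checking; for a concrete m the
  list ranges unfold to finitely many adjacencies.\<close>

lemma graph_iso_complete_minusI:
  assumes G: "pair_graph G"
    and xs: "distinct xs" "length xs = m" "set xs = pverts G"
    and arcs: "\<forall>j \<in> set [0..<m]. \<forall>i \<in> set [0..<j].
      (xs ! i, xs ! j) \<in> parcs G \<longleftrightarrow> (i, j) \<notin> F \<and> (j, i) \<notin> F"
  shows "G \<simeq>\<^sub>g complete_minus m F"
proof (rule graph_iso_nthI[OF G complete_minus_wf pverts_complete_minus xs])
  fix i j assume ij: "i < m" "j < m"
  then consider "i < j" | "i = j" | "j < i" by linarith
  then show "(xs ! i, xs ! j) \<in> parcs G \<longleftrightarrow> (i, j) \<in> parcs (complete_minus m F)"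
  proof cases
    case 1
    then show ?thesis using arcs ij by (simp add: parcs_complete_minus)
  next
    case 2
    then show ?thesis using pair_graph_irrefl[OF G] by (simp add: parcs_complete_minus)
  next
    case 3
    then have "(xs ! j, xs ! i) \<in> parcs G \<longleftrightarrow> (i, j) \<notin> F \<and> (j, i) \<notin> F" using arcs ij by auto
    then show ?thesis using 3 ij pair_graph_symD[OF G] by (auto simp: parcs_complete_minus)
  qed
qed

lemma iso_complete_minus_edgeI:
  assumes G: "pair_graph G" and n: "card (pverts G) = n"
    and ac: "a \<in> pverts G" "c \<in> pverts G" "a \<noteq> c"
    and arcs: "\<And>x y. x \<in> pverts G \<Longrightarrow> y \<in> pverts G \<Longrightarrow> x \<noteq> y \<Longrightarrow> (x, y) \<in> parcs G \<longleftrightarrow> {x, y} \<noteq> {a, c}"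
  shows "\<exists>e \<in> parcs (complete_graph n). G \<simeq>\<^sub>g complete_minus n {e}"
proof -
  obtain xs where xs: "distinct xs" "set xs = pverts G"
    using finite_distinct_list[OF pair_graph_finite[OF G]] by blast
  then have len: "length xs = n" using n distinct_card by fastforce
  obtain p q where pq: "p < n" "q < n" "xs ! p = a" "xs ! q = c"
    using ac xs(2) len by (metis in_set_conv_nth)
  have "G \<simeq>\<^sub>g complete_minus n {(p, q)}"
  proof (rule graph_iso_complete_minusI[OF G xs(1) len xs(2)], intro ballI)
    fix i j assume "j \<in> set [0..<n]" "i \<in> set [0..<j]"
    then have ij: "i < n" "j < n" "i \<noteq> j" by auto
    then have "(xs ! i, xs ! j) \<in> parcs G \<longleftrightarrow> {xs ! i, xs ! j} \<noteq> {xs ! p, xs ! q}"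
      using arcs[of "xs ! i" "xs ! j"] xs len pq nth_mem[of i xs] nth_mem[of j xs]
      by (simp add: nth_eq_iff_index_eq)
    also have "\<dots> \<longleftrightarrow> (i, j) \<notin> {(p, q)} \<and> (j, i) \<notin> {(p, q)}"
      using ij pq xs(1) len by (auto simp: doubleton_eq_iff nth_eq_iff_index_eq)
    finally show "(xs ! i, xs ! j) \<in> parcs G \<longleftrightarrow> (i, j) \<notin> {(p, q)} \<and> (j, i) \<notin> {(p, q)}" .
  qed
  moreover have "p \<noteq> q" using pq ac(3) by auto
  ultimately show ?thesis using pq by (auto simp: complete_graph_def)
qed

lemma iso_pendant_completeI:
  assumes G: "pair_graph G" and n: "card (pverts G) = n"
    and bc: "b \<in> pverts G" "c \<in> pverts G" "b \<noteq> c"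
    and arcs: "\<And>x y. x \<in> pverts G \<Longrightarrow> y \<in> pverts G \<Longrightarrow> x \<noteq> y \<Longrightarrow>
      (x, y) \<in> parcs G \<longleftrightarrow> x \<noteq> c \<and> y \<noteq> c \<or> x = b \<or> y = b"
  shows "G \<simeq>\<^sub>g pendant_complete n"
proof -
  obtain ys where ys: "distinct ys" "set ys = pverts G - {b, c}"
    using finite_distinct_list[of "pverts G - {b, c}"] pair_graph_finite[OF G] by blast
  \<comment> \<open>This order puts the attachment vertex b at index 0 and the pendant vertex c at
    index n - 1, as in \<open>pendant_complete\<close>.\<close>
  define xs where "xs = b # ys @ [c]"
  have xs: "distinct xs" "set xs = pverts G" using ys bc by (auto simp: xs_def)
  then have len: "length xs = n" using n distinct_card by fastforce
  then have n2: "n \<ge> 2" by (simp add: xs_def)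
  have ends: "xs ! 0 = b" "xs ! (n - 1) = c"
    using len by (auto simp: xs_def nth_append)
  have eq: "xs ! i = b \<longleftrightarrow> i = 0" "xs ! i = c \<longleftrightarrow> i = n - 1" if "i < n" for i
    using that n2 len nth_eq_iff_index_eq[OF xs(1), of i 0] nth_eq_iff_index_eq[OF xs(1), of i "n - 1"]
    unfolding ends by simp_all
  show ?thesis
  proof (rule graph_iso_nthI[OF G pendant_complete_wf[OF n2] pverts_pendant_complete[OF n2] xs(1)
    len xs(2)])
    fix i j assume ij: "i < n" "j < n"
    then have mem: "xs ! i \<in> pverts G" "xs ! j \<in> pverts G" using len by (simp_all flip: xs(2))
    show "(xs ! i, xs ! j) \<in> parcs G \<longleftrightarrow> (i, j) \<in> parcs (pendant_complete n)"
    proof (cases "i = j")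
      case True
      then show ?thesis using pair_graph_irrefl[OF G] n2 by (auto simp: parcs_pendant_complete)
    next
      case False
      then have "xs ! i \<noteq> xs ! j" using ij len xs(1) by (simp add: nth_eq_iff_index_eq)
      note arcs[OF mem this, unfolded eq[OF ij(1)] eq[OF ij(2)]]
      then show ?thesis
        unfolding parcs_pendant_complete using ij n2 False by presburger
    qed
  qed
qed

text \<open>All graphs of the four families in one disjunction, without the value of s_3: the
  classification uses only the lower bound n - 3, and the direct computations tell the values apart
  afterwards.\<close>

definition extremal :: "'a pair_pre_digraph \<Rightarrow> bool" where
  "extremal G \<longleftrightarrow>
     (\<exists>e \<in> parcs (complete_graph (card (pverts G))). G \<simeq>\<^sub>g complete_minus (card (pverts G)) {e}) \<or>
     G \<simeq>\<^sub>g pendant_complete (card (pverts G)) \<or>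
     G \<simeq>\<^sub>g K5_minus_2e \<or> G \<simeq>\<^sub>g K5_minus_C4 \<or>
     G \<simeq>\<^sub>g complete_bipartite_graph 2 3 \<or> G \<simeq>\<^sub>g K_minus_C3 5 \<or> G \<simeq>\<^sub>g K_minus_C3 6 \<or>
     G \<simeq>\<^sub>g K7_minus_2C3 \<or> G \<simeq>\<^sub>g complete_bipartite_graph 3 3 \<or> G \<simeq>\<^sub>g K7_minus_K33"

text \<open>Turns a divisibility of a degree into an equation whenever the class sizes keep that
  degree below twice the modulus.\<close>

lemma dvd_imp_eq: "m dvd x \<Longrightarrow> 0 < x \<Longrightarrow> x < 2 * m \<Longrightarrow> x = m" for m x :: int
proof -
  assume "m dvd x" "0 < x" "x < 2 * m"
  then obtain k where k: "x = m * k" by blast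
  have "0 < m" using \<open>0 < x\<close> \<open>x < 2 * m\<close> by linarith
  moreover have "m * 0 < m * k" "m * k < m * 2" using \<open>0 < x\<close> \<open>x < 2 * m\<close> k by linarith+
  ultimately have "0 < k" "k < 2" using mult_less_cancel_left_pos[of m] by blast+
  then show ?thesis using k by simp
qed

text \<open>Since 0 and 1 are distinct modulo m, a congruence for an adjacency indicator decides the
  adjacency.\<close>

lemma dvd_of_boolD:
  assumes "m \<ge> (2 :: int)"
  shows "m dvd 1 - of_bool e \<Longrightarrow> e" "m dvd - of_bool e \<Longrightarrow> \<not> e"
  using assms zdvd_not_zless[of 1 m] by (cases e; simp; fail)+

section \<open>Graphs whose Schur complements vanish modulo a large number\<close>

text \<open>In the application m is s_3. The divisibility is assumed for every induced path, which
  lets the locale be interpreted again for the reversed path c - b - a. Connectedness enters through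
  \<open>neighbour\<close>.\<close>

locale schur_graph =
  fixes G :: "'a pair_pre_digraph" and m :: int and a b c :: 'a
  assumes graph: "pair_graph G"
    and neighbour: "\<And>x. x \<in> pverts G \<Longrightarrow> \<exists>z. (x, z) \<in> parcs G"
    and card_ge: "card (pverts G) \<ge> 5" and m_ge: "m \<ge> int (card (pverts G)) - 3"
    and path: "induced_path G a b c"
    and dvd_schur: "\<And>a b c x y. induced_path G a b c \<Longrightarrow> x \<in> pverts G \<Longrightarrow> y \<in> pverts G \<Longrightarrow>
      m dvd schur G a b c x y"
begin

abbreviation "V \<equiv> pverts G"
abbreviation "E x y \<equiv> (x, y) \<in> parcs G"
abbreviation "da \<equiv> lap G a a"
abbreviation "db \<equiv> lap G b b"
abbreviation "dc \<equiv> lap G c c"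

definition cls :: "bool \<Rightarrow> bool \<Rightarrow> bool \<Rightarrow> 'a set" where
  "cls \<alpha> \<beta> \<gamma> = {x \<in> V. x \<notin> {a, b, c} \<and> E x a = \<alpha> \<and> E x b = \<beta> \<and> E x c = \<gamma>}"

abbreviation "P \<equiv> cls False True False"
abbreviation "Q \<equiv> cls True True False"
abbreviation "R \<equiv> cls False True True"
abbreviation "S \<equiv> cls True False True"
abbreviation "T \<equiv> cls True True True"

section \<open>Congruences for the classes and their adjacencies\<close>

lemma m_ge_2: "m \<ge> 2" using card_ge m_ge by linarith

lemmas bool_dvd = dvd_of_boolD[OF m_ge_2]

lemma not_dvd_1: "\<not> m dvd 1" "\<not> m dvd - 1"
  using m_ge_2 by auto

lemma E_sym: "E x y \<longleftrightarrow> E y x" using pair_graph_symD[OF graph] by blast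

lemma E_irrefl: "\<not> E x x" using pair_graph_irrefl[OF graph] .

lemma path_facts:
  "a \<in> V" "b \<in> V" "c \<in> V" "a \<noteq> b" "b \<noteq> a" "b \<noteq> c" "c \<noteq> b" "a \<noteq> c" "c \<noteq> a"
  "E a b" "E b a" "E b c" "E c b" "\<not> E a c" "\<not> E c a"
  using path pair_graph_vertsD[OF graph] E_sym E_irrefl unfolding induced_path_def by metis+

lemma clsD:
  assumes "x \<in> cls \<alpha> \<beta> \<gamma>"
  shows "x \<in> V" "x \<noteq> a" "x \<noteq> b" "x \<noteq> c" "a \<noteq> x" "b \<noteq> x" "c \<noteq> x"
    "E x a = \<alpha>" "E x b = \<beta>" "E x c = \<gamma>" "E a x = \<alpha>" "E b x = \<beta>" "E c x = \<gamma>"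
  using assms E_sym unfolding cls_def by auto

lemma lap_path:
  "lap G a b = - 1" "lap G b a = - 1" "lap G b c = - 1" "lap G c b = - 1" "lap G a c = 0"
    "lap G c a = 0"
  using path_facts by (simp_all add: lap_def)

lemma lap_cls:
  assumes "x \<in> cls \<alpha> \<beta> \<gamma>"
  shows "lap G x a = - of_bool \<alpha>" "lap G x b = - of_bool \<beta>" "lap G x c = - of_bool \<gamma>"
    "lap G a x = - of_bool \<alpha>" "lap G b x = - of_bool \<beta>" "lap G c x = - of_bool \<gamma>"
  using clsD[OF assms] by (simp_all add: lap_def)

text \<open>Rows a, b and columns b, c of the Schur complement vanish identically, so what ties x to
  the path is the entry in column a and the entry in row c.\<close>

lemma cls_dvd:
  assumes "x \<in> cls \<alpha> \<beta> \<gamma>"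
  shows "m dvd of_bool \<alpha> + (of_bool \<beta> + of_bool \<gamma> * db) * da - of_bool \<gamma>"
    and "m dvd of_bool \<gamma> + (of_bool \<beta> + of_bool \<alpha> * db) * dc - of_bool \<alpha>"
proof -
  have "of_bool \<alpha> + (of_bool \<beta> + of_bool \<gamma> * db) * da - of_bool \<gamma> = - schur G a b c x a"
    by (simp add: schur_def lap_cls[OF assms] lap_path algebra_simps)
  then show "m dvd of_bool \<alpha> + (of_bool \<beta> + of_bool \<gamma> * db) * da - of_bool \<gamma>"
    using dvd_schur[OF path clsD(1)[OF assms] path_facts(1)] by simp
  have "of_bool \<gamma> + (of_bool \<beta> + of_bool \<alpha> * db) * dc - of_bool \<alpha> = - schur G a b c c x"
    by (simp add: schur_def lap_cls[OF assms] lap_path algebra_simps)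
  then show "m dvd of_bool \<gamma> + (of_bool \<beta> + of_bool \<alpha> * db) * dc - of_bool \<alpha>"
    using dvd_schur[OF path path_facts(3) clsD(1)[OF assms]] by simp
qed

text \<open>The expression is not symmetric in x and y although adjacency is. Exchanging the two
  vertices can therefore give a further condition on the degree of b, as in
  \<open>QS_dvd\<close>.\<close>

lemma adj_dvd:
  assumes "x \<in> cls \<alpha> \<beta> \<gamma>" "y \<in> cls \<alpha>' \<beta>' \<gamma>'" "x \<noteq> y"
  shows "m dvd (of_bool \<beta> + of_bool \<gamma> * db) * of_bool \<alpha>' + of_bool \<gamma> * of_bool \<beta>' - of_bool (E x y)"
proof -
  have "lap G x y = - of_bool (E x y)" using assms(3) by (simp add: lap_def)
  then have
    "(of_bool \<beta> + of_bool \<gamma> * db) * of_bool \<alpha>' + of_bool \<gamma> * of_bool \<beta>' - of_bool (E x y) = schur G a b c x y"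
    by (simp add: schur_def lap_cls[OF assms(1)] lap_cls[OF assms(2)] algebra_simps)
  then show ?thesis using dvd_schur[OF path clsD(1)[OF assms(1)] clsD(1)[OF assms(2)]] by simp
qed

text \<open>A vertex adjacent to exactly one end of the path and not to b would give m dvd 1. A
  vertex adjacent to none of a, b, c would, by the congruences, be adjacent to no other vertex at
  all, yet it has a neighbour.\<close>

lemma cls_empty: "cls False False False = {}" "cls True False False = {}" "cls False False True = {}"
proof -
  show t: "cls True False False = {}" "cls False False True = {}"
    using cls_dvd(1)[of _ True False False] cls_dvd(2)[of _ False False True] not_dvd_1 by auto
  show "cls False False False = {}"
  proof (rule ccontr)
    assume "cls False False False \<noteq> {}"
    then obtain x where x: "x \<in> cls False False False" by blast
    obtain z where z: "E x z" using neighbour[OF clsD(1)[OF x]] by blast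
    then have "x \<noteq> z" "z \<in> cls (E z a) (E z b) (E z c)"
      using clsD[OF x] E_irrefl pair_graph_vertsD[OF graph z] unfolding cls_def by auto
    then show False using adj_dvd[OF x, of z] z not_dvd_1 by auto
  qed
qed

lemma finite_V: "finite V" using pair_graph_finite[OF graph] .

lemma finite_cls: "finite (cls \<alpha> \<beta> \<gamma>)"
  using finite_V by (auto simp: cls_def)

lemma V_eq: "V = {a, b, c} \<union> (P \<union> (Q \<union> (R \<union> (S \<union> T))))"
proof (intro equalityI subsetI)
  fix x assume "x \<in> V"
  then have "x \<in> {a, b, c} \<or> x \<in> cls (E x a) (E x b) (E x c)" by (auto simp: cls_def)
  then show "x \<in> {a, b, c} \<union> (P \<union> (Q \<union> (R \<union> (S \<union> T))))"
    using cls_empty by (cases "E x a"; cases "E x b"; cases "E x c") auto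
qed (use path_facts in \<open>auto simp: cls_def\<close>)

lemma cls_disjoint: "(\<alpha>, \<beta>, \<gamma>) \<noteq> (\<alpha>', \<beta>', \<gamma>') \<Longrightarrow> cls \<alpha> \<beta> \<gamma> \<inter> cls \<alpha>' \<beta>' \<gamma>' = {}"
  by (auto simp: cls_def)

lemma cls_path_disjoint: "{a, b, c} \<inter> cls \<alpha> \<beta> \<gamma> = {}" "a \<notin> cls \<alpha> \<beta> \<gamma>" "b \<notin> cls \<alpha> \<beta> \<gamma>" "c \<notin> cls \<alpha> \<beta> \<gamma>"
  by (auto simp: cls_def)

lemma card_V: "card V = 3 + card P + card Q + card R + card S + card T"
  using path_facts
  by (subst V_eq) (simp add: card_Un_disjoint finite_cls cls_disjoint Int_Un_distrib cls_path_disjoint)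

lemma degrees:
  "da = 1 + int (card Q) + int (card S) + int (card T)"
  "db = 2 + int (card P) + int (card Q) + int (card R) + int (card T)"
  "dc = 1 + int (card R) + int (card S) + int (card T)"
proof -
  have V: "E x z \<Longrightarrow> z \<in> {a, b, c} \<union> (P \<union> (Q \<union> (R \<union> (S \<union> T))))" for x z
    using pair_graph_vertsD[OF graph, of x z] V_eq by blast
  have "{z. E a z} = {b} \<union> (Q \<union> (S \<union> T))"
    using V[of a] path_facts E_irrefl by (auto dest: clsD)
  then show "da = 1 + int (card Q) + int (card S) + int (card T)"
    by (simp add: lap_def card_Un_disjoint finite_cls cls_disjoint Int_Un_distrib cls_path_disjoint)
  have "{z. E c z} = {b} \<union> (R \<union> (S \<union> T))"
    using V[of c] path_facts E_irrefl by (auto dest: clsD)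
  then show "dc = 1 + int (card R) + int (card S) + int (card T)"
    by (simp add: lap_def card_Un_disjoint finite_cls cls_disjoint Int_Un_distrib cls_path_disjoint)
  have "{z. E b z} = {a, c} \<union> (P \<union> (Q \<union> (R \<union> T)))"
    using V[of b] path_facts E_irrefl by (auto dest: clsD)
  then show "db = 2 + int (card P) + int (card Q) + int (card R) + int (card T)"
    using path_facts by (simp add: lap_def card_Un_disjoint finite_cls cls_disjoint Int_Un_distrib
      cls_path_disjoint)
qed

section \<open>Conditions imposed by nonempty classes\<close>

lemma P_dvd: "P \<noteq> {} \<Longrightarrow> m dvd da" "P \<noteq> {} \<Longrightarrow> m dvd dc"
  using cls_dvd[of _ False True False] by auto

lemma Q_dvd: "Q \<noteq> {} \<Longrightarrow> m dvd 1 + da" "Q \<noteq> {} \<Longrightarrow> m dvd (1 + db) * dc - 1"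
  using cls_dvd[of _ True True False] by (auto simp: algebra_simps)

lemma R_dvd: "R \<noteq> {} \<Longrightarrow> m dvd 1 + dc" "R \<noteq> {} \<Longrightarrow> m dvd (1 + db) * da - 1"
  using cls_dvd[of _ False True True] by (auto simp: algebra_simps)

lemma S_dvd: "S \<noteq> {} \<Longrightarrow> m dvd db * da" "S \<noteq> {} \<Longrightarrow> m dvd db * dc"
  using cls_dvd[of _ True False True] by auto

lemma T_dvd: "T \<noteq> {} \<Longrightarrow> m dvd (1 + db) * da" "T \<noteq> {} \<Longrightarrow> m dvd (1 + db) * dc"
  using cls_dvd[of _ True True True] by (auto simp: algebra_simps)

lemma cls_distinct:
  "x \<in> cls \<alpha> \<beta> \<gamma> \<Longrightarrow> y \<in> cls \<alpha>' \<beta>' \<gamma>' \<Longrightarrow> (\<alpha>, \<beta>, \<gamma>) \<noteq> (\<alpha>', \<beta>', \<gamma>') \<Longrightarrow> x \<noteq> y"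
  using cls_disjoint[of \<alpha> \<beta> \<gamma> \<alpha>' \<beta>' \<gamma>'] by blast

lemma adj_PS: "E x y" if "x \<in> P" "y \<in> S"
  using bool_dvd(1)[of "E x y"] adj_dvd[OF that cls_distinct[OF that]] by simp

lemma adj_PT: "E x y" if "x \<in> P" "y \<in> T"
  using bool_dvd(1)[of "E x y"] adj_dvd[OF that cls_distinct[OF that]] by simp

lemma adj_QQ: "x \<in> Q \<Longrightarrow> y \<in> Q \<Longrightarrow> x \<noteq> y \<Longrightarrow> E x y"
  using adj_dvd[of x True True False y True True False] bool_dvd(1) by simp

lemma adj_RR: "x \<in> R \<Longrightarrow> y \<in> R \<Longrightarrow> x \<noteq> y \<Longrightarrow> E x y"
  using adj_dvd[of x False True True y False True True] bool_dvd(1) by simp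

lemma adj_QR: "\<not> E x y" if "x \<in> Q" "y \<in> R"
  using bool_dvd(2)[of "E x y"] adj_dvd[OF that cls_distinct[OF that]] by simp

lemma QS_dvd: "Q \<noteq> {} \<Longrightarrow> S \<noteq> {} \<Longrightarrow> m dvd db"
proof -
  assume "Q \<noteq> {}" "S \<noteq> {}"
  then obtain x y where xy: "x \<in> Q" "y \<in> S" by blast
  then have ne: "x \<noteq> y" using clsD(9) by blast
  have "E x y" using adj_dvd[OF xy ne] bool_dvd(1) by simp
  then show "m dvd db" using adj_dvd[OF xy(2,1)] ne E_sym by auto
qed

lemma SS_dvd: "x \<in> S \<Longrightarrow> y \<in> S \<Longrightarrow> x \<noteq> y \<Longrightarrow> m dvd db - of_bool (E x y)"
  using adj_dvd[of x True False True y True False True] by simp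

lemma ST_dvd: "x \<in> S \<Longrightarrow> y \<in> T \<Longrightarrow> m dvd db + 1 - of_bool (E x y)"
  using adj_dvd[of x True False True y True True True] cls_distinct[of x True False True y True True
    True] by simp

lemma TT_dvd: "x \<in> T \<Longrightarrow> y \<in> T \<Longrightarrow> x \<noteq> y \<Longrightarrow> m dvd db + 2 - of_bool (E x y)"
  using adj_dvd[of x True True True y True True True] by (simp add: algebra_simps)

section \<open>Classification by the nonempty classes\<close>

lemma two_elements:
  assumes "card (cls \<alpha> \<beta> \<gamma>) \<ge> 2"
  obtains x y where "x \<in> cls \<alpha> \<beta> \<gamma>" "y \<in> cls \<alpha> \<beta> \<gamma>" "x \<noteq> y"
  using assms by (metis card_le_Suc0_iff_eq finite_cls not_less_eq_eq numeral_2_eq_2)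

lemma nonempty_card: "cls \<alpha> \<beta> \<gamma> \<noteq> {} \<longleftrightarrow> 1 \<le> card (cls \<alpha> \<beta> \<gamma>)"
  using finite_cls by (simp add: Suc_le_eq card_gt_0_iff)

text \<open>It suffices to list the vertices in the order of a model and to compare adjacencies; the
  eight models are those with a fixed number of vertices.\<close>

lemma extremal_listI:
  assumes "distinct xs" "length xs = k" "set xs = V"
    and "complete_minus k F \<in> {K5_minus_2e, K5_minus_C4, complete_bipartite_graph 2 3, K_minus_C3 5, K_minus_C3 6,
      K7_minus_2C3, complete_bipartite_graph 3 3, K7_minus_K33}"
    and "list_all (\<lambda>j. list_all (\<lambda>i. E (xs ! i) (xs ! j) \<longleftrightarrow> (i, j) \<notin> F \<and> (j, i) \<notin> F) [0..<j]) [0..<k]"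
  shows "extremal G"
  using graph_iso_complete_minusI[OF graph assms(1-3) assms(5)[unfolded list_all_iff]] assms(4)
  unfolding extremal_def by auto

text \<open>A vertex in P makes m divide the degrees of a and c, so both equal m. As m is at least
  the sum of all class sizes, P is a single vertex and Q, R are empty. Then m = 1 + s + t = n - 3,
  and every graph found here belongs to that value.\<close>

lemma extremal_if_P:
  assumes "P \<noteq> {}"
  shows "extremal G"
proof -
  define s t where st: "s = card S" "t = card T"
  note size = card_V degrees m_ge m_ge_2 card_ge
  have P1: "card P \<ge> 1" using assms by (simp only: nonempty_card)
  have "da = m" using size P1 by (intro dvd_imp_eq[OF P_dvd(1)[OF assms]]) simp_all
  moreover have "dc = m" using size P1 by (intro dvd_imp_eq[OF P_dvd(2)[OF assms]]) simp_all
  ultimately have cards: "card P = 1" "card Q = 0" "card R = 0" and m: "m = 1 + int s + int t"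
    using size P1 st by linarith+
  have db: "db = 3 + int t" using degrees(2) cards st by simp
  have V: "V = {a, b, c} \<union> (P \<union> (S \<union> T))" using V_eq cards finite_cls by simp
  obtain p where p: "P = {p}" using cards(1) by (rule card_1_singletonE)
  then have p_in: "p \<in> P" by simp
  note facts = path_facts clsD[OF p_in]
  consider (ST) "s \<ge> 1" "t \<ge> 1" | (S) "t = 0" "s \<ge> 1" | (T) "s = 0" "t \<ge> 1"
    using m m_ge_2 by linarith
  then show ?thesis
  proof cases
    case ST
    then obtain x y where xy: "x \<in> S" "y \<in> T" using st nonempty_card by (metis all_not_in_conv)
    show ?thesis
    proof (cases "E x y")
      case True
      then have "m dvd db" using ST_dvd[OF xy] by simp
      then have "db = m" by (rule dvd_imp_eq) (use db m ST in simp_all)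
      then have "s = 2" using db m by simp
      then obtain s1 s2 where S: "S = {s1, s2}" "s1 \<noteq> s2" unfolding st card_2_iff by blast
      have s_in: "s1 \<in> S" "s2 \<in> S" using S by auto
      have nE: "\<not> E s1 s2"
        using dvd_diff[OF \<open>m dvd db\<close> SS_dvd[OF s_in S(2)]] not_dvd_1 by (cases "E s1 s2") simp_all
      have "t = 1"
      proof (rule ccontr)
        assume "t \<noteq> 1"
        then have "card T \<ge> 2" using ST st by simp
        then obtain t1 t2 where t: "t1 \<in> T" "t2 \<in> T" "t1 \<noteq> t2" by (rule two_elements)
        have "m dvd 2 - of_bool (E t1 t2)" using dvd_diff[OF TT_dvd[OF t] \<open>m dvd db\<close>] by simp
        then have "m \<le> 2 - of_bool (E t1 t2)" by (rule zdvd_imp_le) simp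
        then show False using m ST \<open>s = 2\<close> by (cases "E t1 t2") simp_all
      qed
      then obtain t1 where T: "T = {t1}" unfolding st by (rule card_1_singletonE)
      then have t_in: "t1 \<in> T" by simp
      have "db + 1 = m + 1" using \<open>db = m\<close> by simp
      have ET: "E s t1" if "s \<in> S" for s
        using ST_dvd[OF that t_in] \<open>db + 1 = m + 1\<close> not_dvd_1 by (cases "E s t1") simp_all
      \<comment> \<open>The vertices a, c, p are pairwise nonadjacent, and so are b, s1, s2, while
        t1 is adjacent to everything: these are the two deleted triangles.\<close>
      show ?thesis
      proof (rule extremal_listI[of "[a, c, p, b, s1, s2, t1]" 7
        "{(0, 1), (1, 2), (2, 0), (3, 4), (4, 5), (5, 3)}"])
        show "set [a, c, p, b, s1, s2, t1] = V" using V S T p by auto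
      qed (use facts clsD[OF s_in(1)] clsD[OF s_in(2)] clsD[OF t_in] S(2) nE ET[OF s_in(1)]
        ET[OF s_in(2)] adj_PS[OF p_in s_in(1)] adj_PS[OF p_in s_in(2)] adj_PT[OF p_in t_in]
          cls_distinct[OF p_in s_in(1)] cls_distinct[OF p_in s_in(2)] cls_distinct[OF p_in t_in]
            cls_distinct[OF s_in(1) t_in] cls_distinct[OF s_in(2) t_in] in \<open>simp_all add: upt_rec
              K7_minus_2C3_def\<close>)
    next
      \<comment> \<open>Here m = 4 + t, so S has three elements; comparing two of them with the
        divisibility of db + 1 bounds m by 2, a contradiction.\<close>
      case False
      then have "m dvd db + 1" using ST_dvd[OF xy] by simp
      then have "db + 1 = m" by (rule dvd_imp_eq) (use db m ST in simp_all)
      then have "s = 3" "m \<ge> 5" using db m ST by simp_all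
      then obtain s1 s2 where s: "s1 \<in> S" "s2 \<in> S" "s1 \<noteq> s2"
        using two_elements[of True False True] st by auto
      have "m dvd 1 + of_bool (E s1 s2)" using dvd_diff[OF \<open>m dvd db + 1\<close> SS_dvd[OF s]] by simp
      then have "m \<le> 1 + of_bool (E s1 s2)" by (rule zdvd_imp_le) simp
      then show ?thesis using \<open>m \<ge> 5\<close> by (cases "E s1 s2") simp_all
    qed
  next
    case S
    then have T: "T = {}" using st finite_cls by simp
    show ?thesis
    proof (cases "s = 1")
      case True
      then obtain s1 where S: "S = {s1}" unfolding st by (rule card_1_singletonE)
      then have s_in: "s1 \<in> S" by simp
      show ?thesis
      proof (rule extremal_listI[of "[b, s1, a, c, p]" 5
        "{0..<2} \<times> {0..<2} \<union> {2..<2 + 3} \<times> {2..<2 + 3}"])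
        show "set [b, s1, a, c, p] = V" using V S T p by auto
      qed (use facts clsD[OF s_in] adj_PS[OF p_in s_in] E_sym[of s1 p] cls_distinct[OF p_in s_in] in
        \<open>simp_all add: upt_rec complete_bipartite_graph_def\<close>)
    next
      case False
      then have "card S \<ge> 2" "m \<ge> 3" using S st m by simp_all
      then obtain s1 s2 where s: "s1 \<in> S" "s2 \<in> S" "s1 \<noteq> s2" using two_elements by blast
      \<comment> \<open>With T empty the degree of b is 3, which leaves only m = 3 with S
        independent.\<close>
      have "m dvd 3 - of_bool (E s1 s2)" using SS_dvd[OF s] db S by simp
      moreover from this have "m \<le> 3 - of_bool (E s1 s2)" by (rule zdvd_imp_le) simp
      ultimately have nE: "\<not> E s1 s2" and "m = 3" using \<open>m \<ge> 3\<close> by (cases "E s1 s2"; simp)+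
      then have "card S = 2" using m S st by simp
      then have S': "S = {s1, s2}" using s finite_cls by (intro card_subset_eq[symmetric]) auto
      show ?thesis
      proof (rule extremal_listI[of "[a, c, p, b, s1, s2]" 6
        "{0..<3} \<times> {0..<3} \<union> {3..<3 + 3} \<times> {3..<3 + 3}"])
        show "set [a, c, p, b, s1, s2] = V" using V S' T p by auto
      qed (use facts clsD[OF s(1)] clsD[OF s(2)] s(3) nE adj_PS[OF p_in s(1)] adj_PS[OF p_in s(2)]
        cls_distinct[OF p_in s(1)] cls_distinct[OF p_in s(2)] in \<open>simp_all add: upt_rec
          complete_bipartite_graph_def\<close>)
    qed
  next
    case T
    then have S: "S = {}" using st finite_cls by simp
    show ?thesis
    proof (cases "t = 1")
      case True
      then obtain t1 where T': "T = {t1}" unfolding st by (rule card_1_singletonE)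
      then have t_in: "t1 \<in> T" by simp
      show ?thesis
      proof (rule extremal_listI[of "[a, c, p, b, t1]" 5 "{(0, 1), (1, 2), (2, 0)}"])
        show "set [a, c, p, b, t1] = V" using V S T' p by auto
      qed (use facts clsD[OF t_in] adj_PT[OF p_in t_in] cls_distinct[OF p_in t_in] in \<open>simp_all add:
        upt_rec K_minus_C3_def\<close>)
    next
      case False
      then have "card T \<ge> 2" "m \<ge> 3" using T st m by simp_all
      \<comment> \<open>Now db = m + 2, so db + 2 is 4 modulo m. Only m = 3 with all of T adjacent
        and m = 4 with T independent survive.\<close>
      have dvd: "m dvd 4 - of_bool (E x y)" if "x \<in> T" "y \<in> T" "x \<noteq> y" for x y
      proof -
        have "m dvd db - 2" using db m T by simp
        from dvd_diff[OF TT_dvd[OF that] this] show ?thesis by simp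
      qed
      obtain t1 t2 where t: "t1 \<in> T" "t2 \<in> T" "t1 \<noteq> t2" using two_elements[OF \<open>card T \<ge> 2\<close>] by blast
      have "m \<le> 4 - of_bool (E t1 t2)" using dvd[OF t] by (rule zdvd_imp_le) simp
      then consider "E t1 t2" "m = 3" | "\<not> E t1 t2" "m = 4"
        using dvd[OF t] \<open>m \<ge> 3\<close> by (cases "E t1 t2"; cases "m = 3") auto
      then show ?thesis
      proof cases
        case 1
        then have "card T = 2" using m T st by simp
        then have T': "T = {t1, t2}" using t finite_cls by (intro card_subset_eq[symmetric]) auto
        show ?thesis
        proof (rule extremal_listI[of "[a, c, p, b, t1, t2]" 6 "{(0, 1), (1, 2), (2, 0)}"])
          show "set [a, c, p, b, t1, t2] = V" using V S T' p by auto
        qed (use facts clsD[OF t(1)] clsD[OF t(2)] t(3) 1 adj_PT[OF p_in t(1)] adj_PT[OF p_in t(2)]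
          cls_distinct[OF p_in t(1)] cls_distinct[OF p_in t(2)] in \<open>simp_all add: upt_rec
            K_minus_C3_def\<close>)
      next
        case 2
        then have "card T = 3" using m T st by simp
        then obtain t1 t2 t3 where T': "T = {t1, t2, t3}" "t1 \<noteq> t2" "t2 \<noteq> t3" "t1 \<noteq> t3"
          unfolding card_3_iff by blast
        then have t: "t1 \<in> T" "t2 \<in> T" "t3 \<in> T" by auto
        have nE: "\<not> E x y" if "x \<in> T" "y \<in> T" "x \<noteq> y" for x y
          using dvd[OF that] 2 by (cases "E x y") auto
        show ?thesis
        proof (rule extremal_listI[of "[a, c, p, t1, t2, t3, b]" 7
          "{(0, 1), (1, 2), (2, 0), (3, 4), (4, 5), (5, 3)}"])
          show "set [a, c, p, t1, t2, t3, b] = V" using V S T'(1) p by auto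
        qed (use facts clsD[OF t(1)] clsD[OF t(2)] clsD[OF t(3)] T'(2,3,4) nE[OF t(1,2) T'(2)]
          nE[OF t(2,3) T'(3)] nE[OF t(1,3) T'(4)] adj_PT[OF p_in t(1)] adj_PT[OF p_in t(2)]
            adj_PT[OF p_in t(3)] cls_distinct[OF p_in t(1)] cls_distinct[OF p_in t(2)]
              cls_distinct[OF p_in t(3)] in \<open>simp_all add: upt_rec K7_minus_2C3_def\<close>)
      qed
    qed
  qed
qed

text \<open>The congruences of Q contradict those of P and of T, each time with difference 1. If R
  is empty, c is pendant at b. Otherwise the degrees of a and c both equal m - 1, so Q and R have
  equal size.\<close>

lemma extremal_if_Q:
  assumes Q: "Q \<noteq> {}"
  shows "extremal G"
proof -
  note size = card_V degrees m_ge m_ge_2 card_ge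
  have Q1: "card Q \<ge> 1" using Q by (simp only: nonempty_card)
  have P: "P = {}"
  proof (rule ccontr)
    assume "P \<noteq> {}"
    from dvd_diff[OF Q_dvd(1)[OF Q] P_dvd(1)[OF this]] show False using not_dvd_1 by simp
  qed
  have T: "T = {}"
  proof (rule ccontr)
    assume "T \<noteq> {}"
    from dvd_diff[OF T_dvd(2)[OF this] Q_dvd(2)[OF Q]] show False using not_dvd_1 by simp
  qed
  have cards: "card P = 0" "card T = 0" using P T by simp_all
  show ?thesis
  proof (cases "R = {}")
    case True
    have S: "S = {}"
    proof (rule ccontr)
      assume S: "S \<noteq> {}"
      \<comment> \<open>The difference is the size of S, which is less than m because Q also counts
        towards n - 3 <= m.\<close>
      have "m dvd (1 + da) - db" using dvd_diff[OF Q_dvd(1)[OF Q] QS_dvd[OF Q S]] .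
      then have "m dvd int (card S)" using degrees cards True by simp
      moreover have "card S \<ge> 1" using S by (simp only: nonempty_card)
      ultimately have "m \<le> int (card S)" by (intro zdvd_imp_le) simp_all
      then show False using size Q1 by simp
    qed
    have V: "V = {a, b, c} \<union> Q" using V_eq P S T True by simp
    have "G \<simeq>\<^sub>g pendant_complete (card V)"
    proof (rule iso_pendant_completeI[OF graph refl path_facts(2,3,6)])
      fix x y assume "x \<in> V" "y \<in> V" "x \<noteq> y"
      moreover have "x = a \<or> x = b \<or> x = c \<or> x \<in> Q" if "x \<in> V" for x using that V by blast
      ultimately show "E x y \<longleftrightarrow> x \<noteq> c \<and> y \<noteq> c \<or> x = b \<or> y = b"
        using path_facts adj_QQ[of x y] clsD[of x True True False] clsD[of y True True False] by metis
    qed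
    then show ?thesis by (simp add: extremal_def)
  next
    case False
    then have R1: "card R \<ge> 1" by (simp only: nonempty_card)
    have "1 + da = m" using size Q1 R1 cards by (intro dvd_imp_eq[OF Q_dvd(1)[OF Q]]) simp_all
    moreover have "1 + dc = m" using size Q1 R1 cards
      by (intro dvd_imp_eq[OF R_dvd(1)[OF False]]) simp_all
    ultimately have eq: "card R = card Q" and m: "m = 2 + int (card Q) + int (card S)"
      using degrees cards by simp_all
    have S: "S = {}"
    proof (rule ccontr)
      assume S: "S \<noteq> {}"
      \<comment> \<open>Modulo m, db = 0 turns the second condition of Q into dc = 1, while R
        demands dc = -1. So m divides 2, although m is at least 4.\<close>
      have "m dvd db * dc" using QS_dvd[OF Q S] by simp
      from dvd_diff[OF Q_dvd(2)[OF Q] this] have "m dvd dc - 1" by (simp add: algebra_simps)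
      from dvd_diff[OF R_dvd(1)[OF False] this] have "m \<le> 2" by (intro zdvd_imp_le) simp_all
      then show False using m Q1 S by (simp add: nonempty_card)
    qed
    have V: "V = {a, b, c} \<union> (Q \<union> R)" using V_eq P S T by simp
    \<comment> \<open>Here m = 2 + card Q, and it must be at least n - 3 = 2 * card Q.\<close>
    have "card Q = 1 \<or> card Q = 2" using size m eq Q1 cards S by simp linarith
    then show ?thesis
    proof
      assume "card Q = 1"
      then obtain q r where QR: "Q = {q}" "R = {r}" using eq by (metis card_1_singletonE)
      then have in_cls: "q \<in> Q" "r \<in> R" by auto
      show ?thesis
      proof (rule extremal_listI[of "[a, c, q, r, b]" 5 "{(0, 1), (1, 2), (2, 3), (3, 0)}"])
        show "set [a, c, q, r, b] = V" using V QR by auto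
      qed (use path_facts clsD[OF in_cls(1)] clsD[OF in_cls(2)] adj_QR[OF in_cls]
        cls_distinct[OF in_cls] in \<open>simp_all add: upt_rec K5_minus_C4_def\<close>)
    next
      assume "card Q = 2"
      then obtain q1 q2 r1 r2 where QR: "Q = {q1, q2}" "R = {r1, r2}" and ne: "q1 \<noteq> q2" "r1 \<noteq> r2"
        using eq by (metis card_2_iff)
      then have q: "q1 \<in> Q" "q2 \<in> Q" and r: "r1 \<in> R" "r2 \<in> R" by auto
      show ?thesis
      proof (rule extremal_listI[of "[a, q1, q2, c, r1, r2, b]" 7 "{0, 1, 2} \<times> {3, 4, 5}"])
        show "set [a, q1, q2, c, r1, r2, b] = V" using V QR by auto
      qed (use path_facts clsD[OF q(1)] clsD[OF q(2)] clsD[OF r(1)] clsD[OF r(2)] ne adj_QQ[OF q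
        ne(1)] adj_RR[OF r ne(2)] adj_QR[OF q(1) r(1)] adj_QR[OF q(1) r(2)] adj_QR[OF q(2) r(1)]
          adj_QR[OF q(2) r(2)] cls_distinct[OF q(1) r(1)] cls_distinct[OF q(1) r(2)]
            cls_distinct[OF q(2) r(1)] cls_distinct[OF q(2) r(2)] in \<open>simp_all add: upt_rec
              K7_minus_K33_def\<close>)
    qed
  qed
qed

text \<open>Reversing the path exchanges Q and R.\<close>

lemma extremal_if_R:
  assumes "R \<noteq> {}"
  shows "extremal G"
proof -
  have "induced_path G c b a" using path_facts by (simp add: induced_path_def)
  from schur_graph.intro[OF graph neighbour card_ge m_ge this dvd_schur]
  interpret rev: schur_graph G m c b a by blast
  have "rev.cls True True False = R"
    unfolding cls_def rev.cls_def by auto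
  then show ?thesis using rev.extremal_if_Q assms by simp
qed

lemma extremal_if_S_T:
  assumes "P = {}" "Q = {}" "R = {}"
  shows "extremal G"
proof -
  define s t where st: "s = card S" "t = card T"
  have V: "V = {a, b, c} \<union> (S \<union> T)" using V_eq assms by simp
  have da: "da = 1 + int s + int t" and db: "db = 2 + int t" using degrees assms st by simp_all
  have size: "s + t \<ge> 2" "m \<ge> int s + int t" using card_V card_ge m_ge assms st by simp_all
  consider (ST) "s \<ge> 1" "t \<ge> 1" | (S) "t = 0" "s \<ge> 2" | (T) "s = 0" "t \<ge> 2"
    using size by linarith
  then show ?thesis
  proof cases
    case ST
    then have ne: "S \<noteq> {}" "T \<noteq> {}" using st by (simp_all only: nonempty_card)
    then obtain x y where xy: "x \<in> S" "y \<in> T" by blast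
    \<comment> \<open>The conditions of T and S differ by exactly (1 + db) * da - db * da =
      da.\<close>
    have "m dvd da" using dvd_diff[OF T_dvd(1)[OF ne(2)] S_dvd(1)[OF ne(1)]]
      by (simp add: algebra_simps)
    then have "da = m" by (rule dvd_imp_eq) (use da size m_ge_2 in simp_all)
    then have m: "m = 1 + int s + int t" using da by simp
    show ?thesis
    proof (cases "E x y")
      case True
      then have "m dvd db" using ST_dvd[OF xy] by simp
      then have "db = m" by (rule dvd_imp_eq) (use db m ST in simp_all)
      then have "s = 1" using db m by simp
      have "t = 1"
      proof (rule ccontr)
        assume "t \<noteq> 1"
        then have "card T \<ge> 2" using ST st by simp
        then obtain t1 t2 where t: "t1 \<in> T" "t2 \<in> T" "t1 \<noteq> t2" by (rule two_elements)
        have "m dvd 2 - of_bool (E t1 t2)" using dvd_diff[OF TT_dvd[OF t] \<open>m dvd db\<close>] by simp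
        then have "m \<le> 2 - of_bool (E t1 t2)" by (rule zdvd_imp_le) simp
        then show False using m ST \<open>t \<noteq> 1\<close> by (cases "E t1 t2") simp_all
      qed
      then have ST_eq: "S = {x}" "T = {y}" using \<open>s = 1\<close> xy st by (metis card_1_singletonE singletonD)+
      show ?thesis
      proof (rule extremal_listI[of "[a, c, b, x, y]" 5 "{(0, 1), (2, 3)}"])
        show "set [a, c, b, x, y] = V" using V ST_eq by auto
      qed (use path_facts clsD[OF xy(1)] clsD[OF xy(2)] True cls_distinct[OF xy] in \<open>simp_all add:
        upt_rec K5_minus_2e_def\<close>)
    next
      case False
      then have "m dvd db + 1" using ST_dvd[OF xy] by simp
      then have "db + 1 = m" by (rule dvd_imp_eq) (use db m ST in simp_all)
      then have "s = 2" "m \<ge> 4" using db m ST by simp_all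
      then obtain s1 s2 where s: "s1 \<in> S" "s2 \<in> S" "s1 \<noteq> s2"
        using two_elements[of True False True] st by auto
      have "m dvd 1 + of_bool (E s1 s2)" using dvd_diff[OF \<open>m dvd db + 1\<close> SS_dvd[OF s]] by simp
      then have "m \<le> 1 + of_bool (E s1 s2)" by (rule zdvd_imp_le) simp
      then show ?thesis using \<open>m \<ge> 4\<close> by (cases "E s1 s2") simp_all
    qed
  next
    case S
    then have T: "T = {}" using st finite_cls by simp
    obtain s1 s2 where s: "s1 \<in> S" "s2 \<in> S" "s1 \<noteq> s2" using two_elements S st by blast
    have "m dvd 2 - of_bool (E s1 s2)" using SS_dvd[OF s] db S by simp
    moreover from this have "m \<le> 2 - of_bool (E s1 s2)" by (rule zdvd_imp_le) simp
    ultimately have nE: "\<not> E s1 s2" and "m = 2" using m_ge_2 by (cases "E s1 s2"; simp)+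
    then have "card S = 2" using size S st by simp
    then have S': "S = {s1, s2}" using s finite_cls by (intro card_subset_eq[symmetric]) auto
    show ?thesis
    proof (rule extremal_listI[of "[a, c, b, s1, s2]" 5
      "{0..<2} \<times> {0..<2} \<union> {2..<2 + 3} \<times> {2..<2 + 3}"])
      show "set [a, c, b, s1, s2] = V" using V S' T by auto
    qed (use path_facts clsD[OF s(1)] clsD[OF s(2)] s(3) nE in \<open>simp_all add: upt_rec
      complete_bipartite_graph_def\<close>)
  next
    case T
    then have S: "S = {}" and ne: "T \<noteq> {}" using st finite_cls by auto
    have V': "V = {a, b, c} \<union> T" using V S by simp
    show ?thesis
    proof (cases "\<exists>x y. x \<in> T \<and> y \<in> T \<and> x \<noteq> y \<and> \<not> E x y")
      case True
      then obtain t1 t2 where t: "t1 \<in> T" "t2 \<in> T" "t1 \<noteq> t2" "\<not> E t1 t2" by blast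
      have dvd: "m dvd 4 + int t" using TT_dvd[OF t(1-3)] t(4) db by simp
      \<comment> \<open>The multiplier t is chosen so that (3 + t) * (1 + t) - (4 + t) * t is the
        constant 3.\<close>
      have "m dvd (1 + db) * da - (4 + int t) * int t"
        using dvd_diff[OF T_dvd(1)[OF ne] dvd_mult2[OF dvd, of "int t"]] .
      also have "(1 + db) * da - (4 + int t) * int t = 3" using da db T by (simp add: algebra_simps)
      finally have "m dvd 3" .
      then have "m \<le> 3" by (rule zdvd_imp_le) simp
      then have "m = 3" using \<open>m dvd 3\<close> m_ge_2 by (cases "m = 2") auto
      then have "t = 2 \<or> t = 3" using size T by linarith
      then have "card T = 2" using dvd \<open>m = 3\<close> st by auto
      then have T': "T = {t1, t2}" using t finite_cls by (intro card_subset_eq[symmetric]) auto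
      show ?thesis
      proof (rule extremal_listI[of "[a, c, t1, t2, b]" 5 "{(0, 1), (2, 3)}"])
        show "set [a, c, t1, t2, b] = V" using V S T' by auto
      qed (use path_facts clsD[OF t(1)] clsD[OF t(2)] t(3,4) in \<open>simp_all add: upt_rec K5_minus_2e_def\<close>)
    next
      \<comment> \<open>T is now a clique joined to the whole path, so the only nonadjacent pair is
        a, c.\<close>
      case False
      have "\<exists>e \<in> parcs (complete_graph (card V)). G \<simeq>\<^sub>g complete_minus (card V) {e}"
      proof (rule iso_complete_minus_edgeI[OF graph refl path_facts(1,3,8)])
        fix x y assume "x \<in> V" "y \<in> V" "x \<noteq> y"
        moreover have "x = a \<or> x = b \<or> x = c \<or> x \<in> T" if "x \<in> V" for x using that V' by blast
        moreover have "E x y" if "x \<in> T" "y \<in> T" using that False \<open>x \<noteq> y\<close> by blast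
        ultimately show "E x y \<longleftrightarrow> {x, y} \<noteq> {a, c}"
          unfolding doubleton_eq_iff
          using path_facts clsD[of x True True True] clsD[of y True True True] by metis
      qed
      then show ?thesis by (simp add: extremal_def)
    qed
  qed
qed

lemma extremal: "extremal G"
  using extremal_if_P extremal_if_Q extremal_if_R extremal_if_S_T by blast

end

section \<open>The main theorem\<close>

lemma graph_iso_card:
  assumes "pair_graph G" "G \<simeq>\<^sub>g H"
  shows "card (pverts H) = card (pverts G)"
proof -
  have "pair_wf_digraph G"
    using assms(1) by (rule pair_graph_wf)
  then show ?thesis using graph_isoE[OF assms(2)] bij_betw_same_card by metis
qed

theorem mainTheorem1:
  fixes G :: "'a pair_pre_digraph" and n :: nat and v :: "nat \<Rightarrow> 'a"
  assumes simple: "pair_graph G"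
    and conn: "Digraph_Component.connected (with_proj G)"
    and enum: "bij_betw v {..<n} (pverts G)"
    and n_ge_5: "n \<ge> 5"
    and not_complete: "\<not> complete_digraph n (with_proj G)"
  shows "let s\<^sub>3 = invariant_factor (laplacian_mat G n v) 3 in
    s\<^sub>3 \<le> int n
    \<and> (s\<^sub>3 = int n \<longleftrightarrow> (\<exists>e \<in> parcs (complete_graph n). G \<simeq>\<^sub>g complete_minus n {e}))
    \<and> (s\<^sub>3 = int n - 1 \<longleftrightarrow> G \<simeq>\<^sub>g pendant_complete n)
    \<and> (s\<^sub>3 = int n - 2 \<longleftrightarrow> n = 5 \<and> (G \<simeq>\<^sub>g K5_minus_2e \<or> G \<simeq>\<^sub>g K5_minus_C4))
    \<and> (s\<^sub>3 = int n - 3 \<longleftrightarrow>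
         complete_bipartite_digraph 2 3 (with_proj G) \<or>
         G \<simeq>\<^sub>g K_minus_C3 5 \<or>
         G \<simeq>\<^sub>g K_minus_C3 6 \<or>
         G \<simeq>\<^sub>g K7_minus_2C3 \<or>
         complete_bipartite_digraph 3 3 (with_proj G) \<or>
         G \<simeq>\<^sub>g K7_minus_K33)"
proof -
  interpret enumerated_graph G n v by (rule enumerated_graph.intro[OF simple enum])
  have card: "card (pverts G) = n" using bij_betw_same_card[OF enum] by simp
  obtain x y where xy: "x \<in> pverts G" "y \<in> pverts G" "x \<noteq> y" "(x, y) \<notin> parcs G"
  proof (rule ccontr)
    assume "\<not> thesis"
    then have "parcs G = {(x, y). (x, y) \<in> pverts G \<times> pverts G \<and> x \<noteq> y}"
      using that pair_graph_vertsD[OF simple] pair_graph_irrefl[OF simple] by auto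
    then show False
      using not_complete pair_graph_finite[OF simple] card unfolding complete_digraph_pair_def by blast
  qed
  then obtain a b c where path: "induced_path G a b c"
    using ex_induced_path[OF simple conn] by blast
  have neighbour: "\<exists>z. (w, z) \<in> parcs G" if "w \<in> pverts G" for w
    using ex_neighbour[OF simple conn that xy(1)] ex_neighbour[OF simple conn that xy(2)] xy(3) by blast
  have large: "extremal G" if "s3 \<ge> int n - 3"
  proof -
    have "int (card (pverts G)) - 3 \<le> s3" "5 \<le> card (pverts G)" using that n_ge_5 card by simp_all
    from schur_graph.intro[OF simple neighbour this(2,1) path s3_dvd_schur]
    interpret schur_graph G s3 a b c by blast
    show ?thesis by (rule extremal)
  qed
  define A where "A \<longleftrightarrow> (\<exists>e \<in> parcs (complete_graph n). G \<simeq>\<^sub>g complete_minus n {e})"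
  define B where "B \<longleftrightarrow> G \<simeq>\<^sub>g pendant_complete n"
  define C where "C \<longleftrightarrow> G \<simeq>\<^sub>g K5_minus_2e \<or> G \<simeq>\<^sub>g K5_minus_C4"
  define D where
    "D \<longleftrightarrow> complete_bipartite_digraph 2 3 (with_proj G) \<or> G \<simeq>\<^sub>g K_minus_C3 5 \<or> G \<simeq>\<^sub>g K_minus_C3 6 \<or>
    G \<simeq>\<^sub>g K7_minus_2C3 \<or> complete_bipartite_digraph 3 3 (with_proj G) \<or> G \<simeq>\<^sub>g K7_minus_K33"
  note bipartite = complete_bipartite_digraph_iff[OF simple]
  have order: "n = card (pverts H)" if "G \<simeq>\<^sub>g H" for H :: "nat pair_pre_digraph"
    using graph_iso_card[OF simple that] card by simp
  have A: "s3 = int n" if A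
    using that s3_complete_minus_edge[OF n_ge_5] unfolding A_def complete_graph_def by auto
  have B: "s3 = int n - 1" if B
    using that s3_pendant_complete[OF n_ge_5] unfolding B_def by blast
  have C: "s3 = int n - 2 \<and> n = 5" if C
    using that unfolding C_def
  proof
    assume iso: "G \<simeq>\<^sub>g K5_minus_2e"
    show ?thesis using s3_K5_minus_2e[OF iso] order[OF iso] by (simp add: K5_minus_2e_def)
  next
    assume iso: "G \<simeq>\<^sub>g K5_minus_C4"
    show ?thesis using s3_K5_minus_C4[OF iso] order[OF iso] by (simp add: K5_minus_C4_def)
  qed
  have D: "s3 = int n - 3" if D
    using that unfolding D_def bipartite
  proof (elim disjE)
    assume iso: "G \<simeq>\<^sub>g complete_bipartite_graph 2 3"
    show ?thesis using s3_K23[OF iso] order[OF iso] by (simp add: complete_bipartite_graph_def)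
  next
    assume iso: "G \<simeq>\<^sub>g complete_bipartite_graph 3 3"
    show ?thesis using s3_K33[OF iso] order[OF iso] by (simp add: complete_bipartite_graph_def)
  next
    assume iso: "G \<simeq>\<^sub>g K_minus_C3 5"
    show ?thesis using s3_K5_minus_C3[OF iso] order[OF iso] by (simp add: K_minus_C3_def)
  next
    assume iso: "G \<simeq>\<^sub>g K_minus_C3 6"
    show ?thesis using s3_K6_minus_C3[OF iso] order[OF iso] by (simp add: K_minus_C3_def)
  next
    assume iso: "G \<simeq>\<^sub>g K7_minus_2C3"
    show ?thesis using s3_K7_minus_2C3[OF iso] order[OF iso] by (simp add: K7_minus_2C3_def)
  next
    assume iso: "G \<simeq>\<^sub>g K7_minus_K33"
    show ?thesis using s3_K7_minus_K33[OF iso] order[OF iso] by (simp add: K7_minus_K33_def)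
  qed
  \<comment> \<open>The four values are distinct, so this exhaustion together with one computed
    value per family yields all equivalences. It also gives the bound, since a value above n would
    fall under the same exhaustion.\<close>
  have "A \<or> B \<or> C \<or> D" if "s3 \<ge> int n - 3"
    using large[OF that] unfolding extremal_def A_def B_def C_def D_def bipartite card by blast
  then have "s3 \<le> int n \<and> (s3 = int n \<longleftrightarrow> A) \<and> (s3 = int n - 1 \<longleftrightarrow> B) \<and>
      (s3 = int n - 2 \<longleftrightarrow> n = 5 \<and> C) \<and> (s3 = int n - 3 \<longleftrightarrow> D)"
    using A B C D by linarith
  then show ?thesis unfolding Let_def A_def B_def C_def D_def .
qed

end
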